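(* For every $n\in\mathbb N$, the lattice $K_n$ of noncrossing partitions of order $n$ is the quotient of $F_{0,n}$ obtained by inverting the order relations (O1) and (O3), or equivalently by imposing the Beck-Chevalley condition for bicartesian squares. That is, let $\le'$ be the least family of preorders on the $F_{k,n}$ containing $\le$, closed under the congruence conditions ($S\le'T$ implies $e^+S\le'e^+T$ and $m^-S\le'm^-T$), and satisfying in addition the converses of (O1) and (O3); let $\le''$ be defined likewise, but requiring instead of the converses of (O1) and (O3) that $d^-b^+S\le''c^+a^-S$ for every bicartesian square $ab=cd$ in $\Delta$ with $a,d$ mono and $b,c$ epi, and every $S$ over the codomain of $a$. Then $\le'$ and $\le''$ coincide, and the poset obtained from $F_{0,n}$ by identifying $S,T$ whenever $S\le'T\le'S$ is isomorphic to $K_n$.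
   Context: Composition is in diagrammatic order. $\Delta$ is the category of finite ordinals $\mathsf n=\{0,\dots,n-1\}$ (including $\mathsf 0$) and order-preserving maps. $\sigma_i^n:\mathsf{n+1}\to\mathsf n$ ($0\le i<n$) is the order-preserving surjection sending $i$ and $i+1$ to $i$; $\delta_i^n:\mathsf n\to\mathsf{n+1}$ ($0\le i\le n$) is the order-preserving injection whose image omits $i$. Epis (resp. monos) of $\Delta$ are composites of the $\sigma$'s (resp. $\delta$'s). Ambisimplicial formulas $S$ over an ordinal $\mathsf k$, with source $\chi(S)\in\mathbb N$, are generated by: an atom $\mathsf n$ over $\mathsf n$ with $\chi=n$, for each $n\in\mathbb N$; if $S$ is over $\mathsf{n+1}$ then $(\sigma_i^n)^+S$ is over $\mathsf n$ ($0\le i<n$); if $S$ is over $\mathsf{n+1}$ then $(\delta_i^n)^-S$ is over $\mathsf n$ ($0\le i\le n$); these operations do not change $\chi$. $F_{k,n}$ is the poset whose carrier is the set of formulas over $\mathsf k$ with $\chi(S)=n$, modulo the congruence generated by, for $i\le j$ (and $S$ over $\mathsf{m+2}$), (E1) $(\delta_i^m)^-(\delta_{j+1}^{m+1})^-S\equiv(\delta_j^m)^-(\delta_i^{m+1})^-S$, (E2) $(\sigma_i^m)^+(\sigma_{j+1}^{m+1})^+S\equiv(\sigma_j^m)^+(\sigma_i^{m+1})^+S$, and whose order $\le$ is the least preorder (simultaneously for all $k,n$) that is a congruence ($S\le T$ implies $(\sigma_i)^+S\le(\sigma_i)^+T$ and $(\delta_i)^-S\le(\delta_i)^-T$) and contains,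 for $S$ over $\mathsf{m+1}$, (O1) $(\sigma_{j-1}^{m-1})^+(\delta_i^m)^-S\le(\delta_i^{m-1})^-(\sigma_j^m)^+S$ if $i<j$, (O2) $(\delta_i^m)^-S\le(\sigma_j^m)^+S$ if $i=j$ or $i=j+1$, (O3) $(\sigma_j^{m-1})^+(\delta_i^m)^-S\le(\delta_{i-1}^{m-1})^-(\sigma_j^m)^+S$ if $i>j+1$. For an arbitrary epi $e=s_1\cdots s_r$ (each $s_t$ some $\sigma$), $e^+S:=s_r^+\cdots s_1^+S$, and for a mono $m=d_1\cdots d_r$ (each $d_t$ some $\delta$), $m^-S:=d_1^-\cdots d_r^-S$; these are well defined on $F_{k,n}$ by (E1), (E2). A bicartesian square is a commutative square $ab=cd$ that is both a pullback and a pushout; for $a,d$ mono and $b,c$ epi it induces $c^+a^-S\le d^-b^+S$, and the Beck-Chevalley condition asks this to be an equivalence. A noncrossing partition of order $n$ is a partition of $\{0,\dots,n-1\}$ such that there are no $a<b<c<d$ with $a,c$ in one block and $b,d$ in a different block; $K_n$ is the set of these ordered by refinement. *)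

theory Defs
  imports "HOL-Library.FuncSet" "HOL-Library.Disjoint_Sets"
begin

text \<open>
  The ordinal \<open>n\<close> is the set \<open>{..<n}\<close>. Arrows are extensional functions, so that equality of
  arrows with given domain and codomain is equality in HOL. Composition is in diagrammatic order.
\<close>

definition Delta_hom :: "nat \<Rightarrow> nat \<Rightarrow> (nat \<Rightarrow> nat) set" where
  "Delta_hom m n = {f \<in> {..<m} \<rightarrow>\<^sub>E {..<n}. mono_on {..<m} f}"

definition Delta_id :: "nat \<Rightarrow> nat \<Rightarrow> nat" where
  "Delta_id m = restrict (\<lambda>x. x) {..<m}"

definition Delta_comp :: "nat \<Rightarrow> (nat \<Rightarrow> nat) \<Rightarrow> (nat \<Rightarrow> nat) \<Rightarrow> nat \<Rightarrow> nat" where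
  "Delta_comp m f g = compose {..<m} g f"

text \<open>\<open>sigma n i\<close> is an arrow from \<open>n + 1\<close> to \<open>n\<close> if \<open>i < n\<close>, and \<open>delta n i\<close> is an arrow from
  \<open>n\<close> to \<open>n + 1\<close> if \<open>i \<le> n\<close>.\<close>

definition sigma :: "nat \<Rightarrow> nat \<Rightarrow> nat \<Rightarrow> nat" where
  "sigma n i = restrict (\<lambda>x. if x \<le> i then x else x - 1) {..<n + 1}"

definition delta :: "nat \<Rightarrow> nat \<Rightarrow> nat \<Rightarrow> nat" where
  "delta n i = restrict (\<lambda>x. if x < i then x else x + 1) {..<n}"

definition Delta_epi :: "nat \<Rightarrow> nat \<Rightarrow> (nat \<Rightarrow> nat) \<Rightarrow> bool" where
  "Delta_epi m n e \<longleftrightarrow> e \<in> Delta_hom m n \<and>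
     (\<forall>p. \<forall>f \<in> Delta_hom n p. \<forall>g \<in> Delta_hom n p. Delta_comp m e f = Delta_comp m e g \<longrightarrow> f = g)"

definition Delta_mono :: "nat \<Rightarrow> nat \<Rightarrow> (nat \<Rightarrow> nat) \<Rightarrow> bool" where
  "Delta_mono m n d \<longleftrightarrow> d \<in> Delta_hom m n \<and>
     (\<forall>p. \<forall>f \<in> Delta_hom p m. \<forall>g \<in> Delta_hom p m. Delta_comp p f d = Delta_comp p g d \<longrightarrow> f = g)"

text \<open>Squares \<open>a b = c d\<close> with \<open>a : p \<rightarrow> q\<close>, \<open>b : q \<rightarrow> s\<close>, \<open>c : p \<rightarrow> r\<close>, \<open>d : r \<rightarrow> s\<close>.\<close>

definition commuting_square ::
  "nat \<Rightarrow> nat \<Rightarrow> nat \<Rightarrow> nat \<Rightarrow> (nat \<Rightarrow> nat) \<Rightarrow> (nat \<Rightarrow> nat) \<Rightarrow> (nat \<Rightarrow> nat) \<Rightarrow> (nat \<Rightarrow> nat) \<Rightarrow> bool" where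
  "commuting_square p q r s a b c d \<longleftrightarrow>
     a \<in> Delta_hom p q \<and> b \<in> Delta_hom q s \<and> c \<in> Delta_hom p r \<and> d \<in> Delta_hom r s \<and>
     Delta_comp p a b = Delta_comp p c d"

definition pullback_square ::
  "nat \<Rightarrow> nat \<Rightarrow> nat \<Rightarrow> nat \<Rightarrow> (nat \<Rightarrow> nat) \<Rightarrow> (nat \<Rightarrow> nat) \<Rightarrow> (nat \<Rightarrow> nat) \<Rightarrow> (nat \<Rightarrow> nat) \<Rightarrow> bool" where
  "pullback_square p q r s a b c d \<longleftrightarrow> commuting_square p q r s a b c d \<and>
     (\<forall>x. \<forall>f \<in> Delta_hom x q. \<forall>g \<in> Delta_hom x r.
        Delta_comp x f b = Delta_comp x g d \<longrightarrow>
        (\<exists>!h. h \<in> Delta_hom x p \<and> Delta_comp x h a = f \<and> Delta_comp x h c = g))"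

definition pushout_square ::
  "nat \<Rightarrow> nat \<Rightarrow> nat \<Rightarrow> nat \<Rightarrow> (nat \<Rightarrow> nat) \<Rightarrow> (nat \<Rightarrow> nat) \<Rightarrow> (nat \<Rightarrow> nat) \<Rightarrow> (nat \<Rightarrow> nat) \<Rightarrow> bool" where
  "pushout_square p q r s a b c d \<longleftrightarrow> commuting_square p q r s a b c d \<and>
     (\<forall>x. \<forall>f \<in> Delta_hom q x. \<forall>g \<in> Delta_hom r x.
        Delta_comp p a f = Delta_comp p c g \<longrightarrow>
        (\<exists>!h. h \<in> Delta_hom s x \<and> Delta_comp q b h = f \<and> Delta_comp r d h = g))"

definition bicartesian_square ::
  "nat \<Rightarrow> nat \<Rightarrow> nat \<Rightarrow> nat \<Rightarrow> (nat \<Rightarrow> nat) \<Rightarrow> (nat \<Rightarrow> nat) \<Rightarrow> (nat \<Rightarrow> nat) \<Rightarrow> (nat \<Rightarrow> nat) \<Rightarrow> bool" where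
  "bicartesian_square p q r s a b c d \<longleftrightarrow>
     pullback_square p q r s a b c d \<and> pushout_square p q r s a b c d"

text \<open>\<open>Sig n i S\<close> is $(\sigma_i^n)^+S$ and \<open>Del n i S\<close> is $(\delta_i^n)^-S$. The datatype also contains
  ill-typed terms; the formulas over \<open>k\<close> are the terms \<open>S\<close> with \<open>over S k\<close>.\<close>

datatype formula = Atom nat | Sig nat nat formula | Del nat nat formula

inductive over :: "formula \<Rightarrow> nat \<Rightarrow> bool" where
  over_Atom: "over (Atom n) n"
| over_Sig: "over S (n + 1) \<Longrightarrow> i < n \<Longrightarrow> over (Sig n i S) n"
| over_Del: "over S (n + 1) \<Longrightarrow> i \<le> n \<Longrightarrow> over (Del n i S) n"

primrec source :: "formula \<Rightarrow> nat" where
  "source (Atom n) = n"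
| "source (Sig n i S) = source S"
| "source (Del n i S) = source S"

inductive formula_eq :: "formula \<Rightarrow> formula \<Rightarrow> bool" where
  feq_refl: "formula_eq S S"
| feq_sym: "formula_eq S T \<Longrightarrow> formula_eq T S"
| feq_trans: "formula_eq S T \<Longrightarrow> formula_eq T U \<Longrightarrow> formula_eq S U"
| feq_Sig: "formula_eq S T \<Longrightarrow> formula_eq (Sig n i S) (Sig n i T)"
| feq_Del: "formula_eq S T \<Longrightarrow> formula_eq (Del n i S) (Del n i T)"
| feq_E1: "over S (m + 2) \<Longrightarrow> i \<le> j \<Longrightarrow> j \<le> m \<Longrightarrow>
    formula_eq (Del m i (Del (m + 1) (j + 1) S)) (Del m j (Del (m + 1) i S))"
| feq_E2: "over S (m + 2) \<Longrightarrow> i \<le> j \<Longrightarrow> j < m \<Longrightarrow>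
    formula_eq (Sig m i (Sig (m + 1) (j + 1) S)) (Sig m j (Sig (m + 1) i S))"

lemma over_Sig_iff: "over (Sig n i S) k \<longleftrightarrow> k = n \<and> i < n \<and> over S (n + 1)"
  by (auto intro: over.intros elim: over.cases)

lemma over_Del_iff: "over (Del n i S) k \<longleftrightarrow> k = n \<and> i \<le> n \<and> over S (n + 1)"
  by (auto intro: over.intros elim: over.cases)

lemma formula_eq_over: "formula_eq S T \<Longrightarrow> over S k \<longleftrightarrow> over T k"
  by (induction arbitrary: k rule: formula_eq.induct) (auto simp: over_Sig_iff over_Del_iff)

lemma formula_eq_source: "formula_eq S T \<Longrightarrow> source S = source T"
  by (induction rule: formula_eq.induct) auto

lemma equivp_formula_eq: "equivp formula_eq"
  by (rule equivpI) (auto intro!: reflpI sympI transpI intro: formula_eq.intros)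

quotient_type fclass = formula / formula_eq
  by (rule equivp_formula_eq)

lift_definition fc_over :: "fclass \<Rightarrow> nat \<Rightarrow> bool" is over
  by (auto simp: fun_eq_iff formula_eq_over)

lift_definition fc_source :: "fclass \<Rightarrow> nat" is source
  by (rule formula_eq_source)

lift_definition sig_plus :: "nat \<Rightarrow> nat \<Rightarrow> fclass \<Rightarrow> fclass" is Sig
  by (rule feq_Sig)

lift_definition del_minus :: "nat \<Rightarrow> nat \<Rightarrow> fclass \<Rightarrow> fclass" is Del
  by (rule feq_Del)

definition F :: "nat \<Rightarrow> nat \<Rightarrow> fclass set" where
  "F k n = {x. fc_over x k \<and> fc_source x = n}"

text \<open>Families of relations on the sets \<open>F k n\<close> are indexed by \<open>k\<close> and \<open>n\<close>. The instances of
  \<open>O1\<close> and \<open>O3\<close> live over \<open>m - 1\<close>; their side conditions force \<open>m \<ge> 2\<close>.\<close>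

type_synonym family = "nat \<Rightarrow> nat \<Rightarrow> fclass \<Rightarrow> fclass \<Rightarrow> bool"

inductive O1 :: family where
  "x \<in> F (m + 1) n \<Longrightarrow> i < j \<Longrightarrow> j < m \<Longrightarrow>
    O1 (m - 1) n (sig_plus (m - 1) (j - 1) (del_minus m i x)) (del_minus (m - 1) i (sig_plus m j x))"

inductive O2 :: family where
  "x \<in> F (m + 1) n \<Longrightarrow> i = j \<or> i = j + 1 \<Longrightarrow> j < m \<Longrightarrow>
    O2 m n (del_minus m i x) (sig_plus m j x)"

inductive O3 :: family where
  "x \<in> F (m + 1) n \<Longrightarrow> i > j + 1 \<Longrightarrow> i \<le> m \<Longrightarrow>
    O3 (m - 1) n (sig_plus (m - 1) j (del_minus m i x)) (del_minus (m - 1) (i - 1) (sig_plus m j x))"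

inductive F_le :: family where
  F_le_refl: "x \<in> F k n \<Longrightarrow> F_le k n x x"
| F_le_trans: "F_le k n x y \<Longrightarrow> F_le k n y z \<Longrightarrow> F_le k n x z"
| F_le_sig: "F_le (k + 1) n x y \<Longrightarrow> i < k \<Longrightarrow> F_le k n (sig_plus k i x) (sig_plus k i y)"
| F_le_del: "F_le (k + 1) n x y \<Longrightarrow> i \<le> k \<Longrightarrow> F_le k n (del_minus k i x) (del_minus k i y)"
| F_le_O1: "O1 k n x y \<Longrightarrow> F_le k n x y"
| F_le_O2: "O2 k n x y \<Longrightarrow> F_le k n x y"
| F_le_O3: "O3 k n x y \<Longrightarrow> F_le k n x y"

text \<open>\<open>epi_act k l e x y\<close>: for some factorization $e = s_1 \cdots s_r$ of \<open>e : k \<rightarrow> l\<close> into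
  $\sigma$'s, $y = s_r^+ \cdots s_1^+ x$.\<close>

inductive epi_act :: "nat \<Rightarrow> nat \<Rightarrow> (nat \<Rightarrow> nat) \<Rightarrow> fclass \<Rightarrow> fclass \<Rightarrow> bool" where
  epi_act_id: "epi_act k k (Delta_id k) x x"
| epi_act_sigma: "i < k \<Longrightarrow> epi_act k l e (sig_plus k i x) y \<Longrightarrow>
    epi_act (k + 1) l (Delta_comp (k + 1) (sigma k i) e) x y"

text \<open>\<open>mono_act k l d x y\<close>: for some factorization $d = d_1 \cdots d_r$ of \<open>d : k \<rightarrow> l\<close> into
  $\delta$'s, $y = d_1^- \cdots d_r^- x$.\<close>

inductive mono_act :: "nat \<Rightarrow> nat \<Rightarrow> (nat \<Rightarrow> nat) \<Rightarrow> fclass \<Rightarrow> fclass \<Rightarrow> bool" where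
  mono_act_id: "mono_act k k (Delta_id k) x x"
| mono_act_delta: "i \<le> k \<Longrightarrow> mono_act (k + 1) l d x y \<Longrightarrow>
    mono_act k l (Delta_comp k (delta k i) d) x (del_minus k i y)"

text \<open>The results do not depend on the factorization if \<open>e : k \<rightarrow> l\<close> is epi and \<open>x\<close> is over \<open>k\<close>,
  respectively if \<open>d : k \<rightarrow> l\<close> is mono and \<open>x\<close> is over \<open>l\<close>.\<close>

definition epi_plus :: "nat \<Rightarrow> nat \<Rightarrow> (nat \<Rightarrow> nat) \<Rightarrow> fclass \<Rightarrow> fclass" where
  "epi_plus k l e x = (THE y. epi_act k l e x y)"

definition mono_minus :: "nat \<Rightarrow> nat \<Rightarrow> (nat \<Rightarrow> nat) \<Rightarrow> fclass \<Rightarrow> fclass" where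
  "mono_minus k l d x = (THE y. mono_act k l d x y)"

inductive gen_le :: "family \<Rightarrow> family" for R :: family where
  gen_le_refl: "x \<in> F k n \<Longrightarrow> gen_le R k n x x"
| gen_le_trans: "gen_le R k n x y \<Longrightarrow> gen_le R k n y z \<Longrightarrow> gen_le R k n x z"
| gen_le_F_le: "F_le k n x y \<Longrightarrow> gen_le R k n x y"
| gen_le_epi: "gen_le R k n x y \<Longrightarrow> Delta_epi k l e \<Longrightarrow>
    gen_le R l n (epi_plus k l e x) (epi_plus k l e y)"
| gen_le_mono: "gen_le R l n x y \<Longrightarrow> Delta_mono k l d \<Longrightarrow>
    gen_le R k n (mono_minus k l d x) (mono_minus k l d y)"
| gen_le_base: "R k n x y \<Longrightarrow> gen_le R k n x y"

definition O13_converse :: family where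
  "O13_converse k n x y \<longleftrightarrow> O1 k n y x \<or> O3 k n y x"

inductive beck_chevalley :: family where
  "bicartesian_square p q r s a b c d \<Longrightarrow>
   Delta_mono p q a \<Longrightarrow> Delta_mono r s d \<Longrightarrow> Delta_epi q s b \<Longrightarrow> Delta_epi p r c \<Longrightarrow> x \<in> F q n \<Longrightarrow>
   beck_chevalley r n (mono_minus r s d (epi_plus q s b x)) (epi_plus p r c (mono_minus p q a x))"

definition F_le' :: family where
  "F_le' = gen_le O13_converse"

definition F_le'' :: family where
  "F_le'' = gen_le beck_chevalley"

definition preorder_quotient :: "'a set \<Rightarrow> ('a \<Rightarrow> 'a \<Rightarrow> bool) \<Rightarrow> 'a set set" where
  "preorder_quotient A le = A // {(x, y). x \<in> A \<and> y \<in> A \<and> le x y \<and> le y x}"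

definition quotient_le :: "('a \<Rightarrow> 'a \<Rightarrow> bool) \<Rightarrow> 'a set \<Rightarrow> 'a set \<Rightarrow> bool" where
  "quotient_le le X Y \<longleftrightarrow> (\<exists>x\<in>X. \<exists>y\<in>Y. le x y)"

definition order_isomorphic ::
  "'a set \<Rightarrow> ('a \<Rightarrow> 'a \<Rightarrow> bool) \<Rightarrow> 'b set \<Rightarrow> ('b \<Rightarrow> 'b \<Rightarrow> bool) \<Rightarrow> bool" where
  "order_isomorphic A leA B leB \<longleftrightarrow>
     (\<exists>f. bij_betw f A B \<and> (\<forall>x\<in>A. \<forall>y\<in>A. leA x y \<longleftrightarrow> leB (f x) (f y)))"

definition noncrossing :: "nat set set \<Rightarrow> bool" where
  "noncrossing P \<longleftrightarrow> \<not> (\<exists>a b c d. a < b \<and> b < c \<and> c < d \<and>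
     (\<exists>X\<in>P. \<exists>Y\<in>P. X \<noteq> Y \<and> a \<in> X \<and> c \<in> X \<and> b \<in> Y \<and> d \<in> Y))"

definition K :: "nat \<Rightarrow> nat set set set" where
  "K n = {P. partition_on {..<n} P \<and> noncrossing P}"

end

theory Submission
  imports Defs
begin

text \<open>
  A formula of source \<open>n\<close> over \<open>k\<close> is read as a history of \<open>n\<close> points on a line, each starting
  as an open block of its own: $\sigma_i^+$ merges the open blocks at positions \<open>i\<close> and \<open>i + 1\<close>,
  and $\delta_i^-$ closes the open block at position \<open>i\<close>. The outcome is a noncrossing partition
  of the points together with a monotone labelling of the points in open blocks by the \<open>k\<close>
  remaining positions. Say that one outcome is below another if its partition is finer and its
  labelling is a restriction of that of the other. Everything follows once both \<open>F_le'\<close> and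
  \<open>F_le''\<close> are known to coincide with this relation: over \<open>0\<close> all blocks are closed, so the
  relation is refinement, and every noncrossing partition arises.

  Soundness is direct. The sides of (O1) and of (O3) have the same outcome, and those of (O2) have
  comparable ones. For a bicartesian square of epis and monos, pullback says that the two
  composites \<open>b\<close>, then \<open>d\<close> backwards, and \<open>a\<close> backwards, then \<open>c\<close>, are the same partial map, and
  pushout says that \<open>b\<close> merges nothing outside the image of \<open>a\<close>. The operations \<open>epi_plus\<close> and
  \<open>mono_minus\<close> are understood through \<open>epi_act_unique\<close> and \<open>mono_act_unique\<close>. In the other
  direction, the squares formed by one $\sigma$ and one $\delta$ that occur in (O1) and (O3) are
  bicartesian, so \<open>F_le''\<close> contains the converses of (O1) and (O3).

  Completeness (\<open>formula_le_complete\<close>) is an induction on the source. A formula that is not an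
  atom can be stripped of the generator applied first, adjacent to the atom. Modulo (E1), (E2) and
  the invertible (O1) and (O3), a formula in which \<open>j\<close> and \<open>j + 1\<close> lie in one block can be
  rewritten to begin with $\sigma_j$ (\<open>adjacent_same_front_sig\<close>), and one in which \<open>{j}\<close> is a closed
  block to begin with $\delta_j$ (\<open>closed_singleton_front_del\<close>). Suppose \<open>S\<close> is below \<open>T\<close>. If \<open>T\<close>
  begins with $\delta_j$, then so does \<open>S\<close>, up to rewriting, and $\delta_j$ can be cancelled. If \<open>T\<close>
  begins with $\sigma_j$, then (O2) raises \<open>S\<close> to a formula still below \<open>T\<close> in which \<open>j\<close> and
  \<open>j + 1\<close> are in one block (\<open>below_join\<close>), and $\sigma_j$ can be cancelled.
\<close>

section \<open>Blocks and open positions of a formula\<close>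

text \<open>The map $\sigma_i$, extended to all natural numbers.\<close>

definition merge_at :: "nat \<Rightarrow> nat \<Rightarrow> nat" where
  "merge_at i v = (if v \<le> i then v else v - 1)"

text \<open>The partial inverse of \<open>skip_at i\<close>.\<close>

definition remove_at :: "nat \<Rightarrow> nat \<Rightarrow> nat option" where
  "remove_at i v = (if v = i then None else if v < i then Some v else Some (v - 1))"

text \<open>The map $\delta_i$, extended to all natural numbers.\<close>

definition skip_at :: "nat \<Rightarrow> nat \<Rightarrow> nat" where
  "skip_at i v = (if v < i then v else v + 1)"

text \<open>\<open>label S x = Some v\<close> if the block of the point \<open>x\<close> is open and sits at position \<open>v\<close>;
  \<open>None\<close> if it is closed, or if \<open>x\<close> is not below the source of \<open>S\<close>.\<close>

primrec label :: "formula \<Rightarrow> nat \<Rightarrow> nat option" where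
  "label (Atom n) x = (if x < n then Some x else None)"
| "label (Sig n i S) x = map_option (merge_at i) (label S x)"
| "label (Del n i S) x = Option.bind (label S x) (remove_at i)"

text \<open>\<open>same S x y\<close>: the points \<open>x\<close> and \<open>y\<close> lie in the same block, open or closed.\<close>

primrec same :: "formula \<Rightarrow> nat \<Rightarrow> nat \<Rightarrow> bool" where
  "same (Atom n) x y \<longleftrightarrow> x = y \<and> x < n"
| "same (Sig n i S) x y \<longleftrightarrow> same S x y \<or>
     (\<exists>v w. label S x = Some v \<and> label S y = Some w \<and> merge_at i v = merge_at i w)"
| "same (Del n i S) x y \<longleftrightarrow> same S x y"

lemma merge_at_mono: "v \<le> w \<Longrightarrow> merge_at i v \<le> merge_at i w"
  by (auto simp: merge_at_def)

lemma merge_at_eq_iff: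
  "merge_at i v = merge_at i w \<longleftrightarrow> v = w \<or> v = i \<and> w = Suc i \<or> v = Suc i \<and> w = i"
  by (auto simp: merge_at_def)

lemma skip_at_merge_at: "x \<noteq> i \<Longrightarrow> skip_at i (merge_at i x) = x"
  by (auto simp: skip_at_def merge_at_def)

lemma skip_at_less: "v < k \<Longrightarrow> skip_at i v < Suc k"
  by (simp add: skip_at_def)

lemma remove_at_eq_Some: "remove_at i v = Some w \<longleftrightarrow> v = skip_at i w"
  by (auto simp: remove_at_def skip_at_def split: if_splits)

lemma skip_at_le_iff [simp]: "skip_at i v \<le> skip_at i w \<longleftrightarrow> v \<le> w"
  by (auto simp: skip_at_def)

lemma skip_at_less_iff [simp]: "skip_at i v < skip_at i w \<longleftrightarrow> v < w"
  by (auto simp: skip_at_def)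

lemma skip_at_eq_iff [simp]: "skip_at i v = skip_at i w \<longleftrightarrow> v = w"
  by (auto simp: skip_at_def)

lemma label_Del_eq_Some: "label (Del n i S) x = Some v \<longleftrightarrow> label S x = Some (skip_at i v)"
  by (auto simp: bind_eq_Some_conv remove_at_eq_Some)

lemma label_bounds: "over S k \<Longrightarrow> label S x = Some v \<Longrightarrow> x < source S \<and> v < k"
proof (induction arbitrary: v rule: over.induct)
  case (over_Sig S n i)
  then show ?case by (fastforce simp: merge_at_def)
next
  case (over_Del S n i)
  then show ?case by (fastforce simp: label_Del_eq_Some skip_at_def simp del: label.simps split: if_splits)
qed (auto split: if_splits)

lemma label_surj: "over S k \<Longrightarrow> v < k \<Longrightarrow> \<exists>x. label S x = Some v"
proof (induction arbitrary: v rule: over.induct)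
  case (over_Sig S n i)
  obtain x where "label S x = Some (skip_at i v)"
    using over_Sig.IH[of "skip_at i v"] over_Sig.prems by (fastforce simp: skip_at_def)
  moreover have "merge_at i (skip_at i v) = v"
    by (auto simp: merge_at_def skip_at_def)
  ultimately show ?case by auto
next
  case (over_Del S n i)
  obtain x where "label S x = Some (skip_at i v)"
    using over_Del.IH[of "skip_at i v"] over_Del.prems by (fastforce simp: skip_at_def)
  then show ?case by (metis label_Del_eq_Some)
qed auto

lemma label_mono:
  "label S x = Some v \<Longrightarrow> label S y = Some w \<Longrightarrow> x \<le> y \<Longrightarrow> v \<le> w"
proof (induction S arbitrary: v w)
  case (Del n i S)
  then show ?case by (metis label_Del_eq_Some skip_at_le_iff)
qed (auto split: if_splits intro: merge_at_mono)

text \<open>Neighbouring points with distinct open labels have consecutive labels, since every position in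
  between would have to be the label of a point in between.\<close>

lemma label_consecutive:
  assumes "over S k" "label S x = Some v" "label S (Suc x) = Some w" "v < w"
  shows "w = Suc v"
proof (rule ccontr)
  assume "w \<noteq> Suc v"
  with assms have "Suc v < k" using label_bounds by fastforce
  then obtain z where z: "label S z = Some (Suc v)" using assms(1) label_surj by blast
  have "z \<le> x \<or> Suc x \<le> z" by auto
  then show False
    using label_mono[OF z assms(2)] label_mono[OF assms(3) z] \<open>w \<noteq> Suc v\<close> assms(4) by auto
qed

lemma same_refl: "x < source S \<Longrightarrow> same S x x"
  by (induction S) auto

lemma same_sym: "same S x y \<Longrightarrow> same S y x"
  by (induction S) fastforce+

lemma same_label: "same S x y \<Longrightarrow> label S x = label S y"
  by (induction S) auto

lemma same_if_label:
  "label S x = Some v \<Longrightarrow> label S y = Some v \<Longrightarrow> same S x y"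
  by (induction S arbitrary: v) (auto simp: bind_eq_Some_conv remove_at_eq_Some split: if_splits)

lemma same_trans: "same S x y \<Longrightarrow> same S y z \<Longrightarrow> same S x z"
proof (induction S)
  case (Sig n i S)
  show ?case
  proof (cases "same S x y \<and> same S y z")
    case True
    then show ?thesis using Sig.IH by simp
  next
    case False
    with Sig.prems obtain v where v: "label S x = Some v"
      by (auto dest: same_label)
    have "label (Sig n i S) x = label (Sig n i S) z"
      using Sig.prems by (metis same_label)
    with v show ?thesis by (cases "label S z") auto
  qed
qed auto

lemma same_bounds: "over S k \<Longrightarrow> same S x y \<Longrightarrow> x < source S \<and> y < source S"
  by (induction rule: over.induct) (auto dest: label_bounds)

lemma same_Sig:
  "same (Sig n i S) x y \<longleftrightarrow> same S x y \<or> label S x = Some i \<and> label S y = Some (Suc i)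
    \<or> label S x = Some (Suc i) \<and> label S y = Some i"
  using same_if_label by (auto simp: merge_at_eq_iff)

text \<open>A point of an open block is never enclosed by a different block: only adjacent open blocks
  are merged, so whatever lies between two points of a block is closed or belongs to it.\<close>

lemma label_not_enclosed:
  assumes "same S x z" "x < y" "y < z" "label S y = Some v"
  shows "label S x = Some v"
  using assms
proof (induction S arbitrary: v)
  case (Sig n i S)
  obtain w where w: "label S y = Some w" "v = merge_at i w" using Sig.prems by auto
  show ?case
  proof (cases "same S x z")
    case True
    then show ?thesis using Sig w by auto
  next
    case False
    then obtain a b where ab: "label S x = Some a" "label S z = Some b" "merge_at i a = merge_at i b"
      using Sig.prems by auto
    then have "a \<le> w" "w \<le> b" using w Sig.prems label_mono by (metis less_imp_le)+
    then show ?thesis using ab w merge_at_mono by (metis label.simps(2) le_antisym option.simps(9))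
  qed
next
  case (Del n i S)
  then show ?case by (simp add: label_Del_eq_Some del: label.simps)
qed auto

lemma same_noncrossing:
  assumes "same S a c" "same S b d" "a < b" "b < c" "c < d"
  shows "same S a b"
  using assms
proof (induction S)
  case (Sig n i S)
  consider "same S a c" "same S b d" | v where "label S b = Some v" "same S a c"
    | v where "label S c = Some v" "same S b d"
    | v u where "label (Sig n i S) a = Some v" "label (Sig n i S) c = Some v" "label (Sig n i S) b = Some u"
    using Sig.prems by auto
  then show ?case
  proof cases
    case 1
    then show ?thesis using Sig by auto
  next
    case (2 v)
    then show ?thesis using label_not_enclosed[of S a c b] Sig.prems by (metis same.simps(2) same_if_label)
  next
    case (3 v)
    then have "label S b = Some v" using label_not_enclosed[of S b d c] Sig.prems by simp
    then have "same S b c" using 3 same_if_label by blast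
    then have "same (Sig n i S) b c" by simp
    then show ?thesis using Sig.prems same_sym same_trans by blast
  next
    case (4 v u)
    then have "u = v" using label_mono Sig.prems by (meson le_antisym less_imp_le)
    then show ?thesis using 4 same_if_label by blast
  qed
qed auto

lemma label_formula_eq: "formula_eq S T \<Longrightarrow> label S = label T"
proof (induction rule: formula_eq.induct)
  case (feq_E1 S m i j)
  have "label (Del m i (Del (m + 1) (j + 1) S)) x = Some v
    \<longleftrightarrow> label (Del m j (Del (m + 1) i S)) x = Some v" for x v
    using feq_E1 by (simp add: label_Del_eq_Some skip_at_def del: label.simps)
  then show ?case by (metis ext not_None_eq)
next
  case (feq_E2 S m i j)
  then have "merge_at i (merge_at (j + 1) v) = merge_at j (merge_at i v)" for v
    by (auto simp: merge_at_def)
  then show ?case by (auto simp: fun_eq_iff option.map_comp comp_def)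
qed (auto simp: fun_eq_iff)

lemma same_formula_eq: "formula_eq S T \<Longrightarrow> same S = same T"
proof (induction rule: formula_eq.induct)
  case (feq_Sig S T n i)
  then show ?case using label_formula_eq by (fastforce simp: fun_eq_iff)
next
  case (feq_E2 S m i j)
  then have eq: "merge_at i (merge_at (j + 1) v) = merge_at j (merge_at i v)" for v
    by (auto simp: merge_at_def)
  then show ?case by (auto simp: fun_eq_iff) (metis eq Suc_eq_plus1)+
qed (auto simp: fun_eq_iff)

section \<open>Formulas ordered with (O1) and (O3) inverted\<close>

text \<open>The counterpart of \<open>F_le'\<close> on formulas instead of classes, with \<open>O1\<close> and \<open>O3\<close> in both directions
  and (E1), (E2) absorbed into \<open>formula_eq\<close>. The indices of (O1) and (O3) are shifted by one, so
  that no subtraction occurs in the level \<open>m\<close>. The congruence rules do not ask for well-typed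
  formulas; the axioms do.\<close>

inductive formula_le :: "formula \<Rightarrow> formula \<Rightarrow> bool" where
  fle_eq: "formula_eq S T \<Longrightarrow> formula_le S T"
| fle_trans [trans]: "formula_le S T \<Longrightarrow> formula_le T U \<Longrightarrow> formula_le S U"
| fle_Sig: "formula_le S T \<Longrightarrow> formula_le (Sig n i S) (Sig n i T)"
| fle_Del: "formula_le S T \<Longrightarrow> formula_le (Del n i S) (Del n i T)"
| fle_O1: "over S (m + 2) \<Longrightarrow> i < j \<Longrightarrow> j \<le> m \<Longrightarrow>
    formula_le (Sig m (j - 1) (Del (m + 1) i S)) (Del m i (Sig (m + 1) j S))"
| fle_O1': "over S (m + 2) \<Longrightarrow> i < j \<Longrightarrow> j \<le> m \<Longrightarrow>
    formula_le (Del m i (Sig (m + 1) j S)) (Sig m (j - 1) (Del (m + 1) i S))"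
| fle_O2: "over S (m + 1) \<Longrightarrow> i = j \<or> i = j + 1 \<Longrightarrow> j < m \<Longrightarrow>
    formula_le (Del m i S) (Sig m j S)"
| fle_O3: "over S (m + 2) \<Longrightarrow> i > j + 1 \<Longrightarrow> i \<le> m + 1 \<Longrightarrow>
    formula_le (Sig m j (Del (m + 1) i S)) (Del m (i - 1) (Sig (m + 1) j S))"
| fle_O3': "over S (m + 2) \<Longrightarrow> i > j + 1 \<Longrightarrow> i \<le> m + 1 \<Longrightarrow>
    formula_le (Del m (i - 1) (Sig (m + 1) j S)) (Sig m j (Del (m + 1) i S))"

lemma fle_refl: "formula_le S S"
  by (intro fle_eq feq_refl)

lemma formula_le_over: "formula_le S T \<Longrightarrow> over S k \<longleftrightarrow> over T k"
proof (induction arbitrary: k rule: formula_le.induct)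
  case (fle_eq S T)
  then show ?case by (rule formula_eq_over)
qed (auto simp: over_Sig_iff over_Del_iff)

lemma formula_le_source: "formula_le S T \<Longrightarrow> source S = source T"
  by (induction rule: formula_le.induct) (auto simp: formula_eq_source)

text \<open>Formulas identified by the preorder.\<close>

abbreviation formula_equiv :: "formula \<Rightarrow> formula \<Rightarrow> bool" where
  "formula_equiv S T \<equiv> formula_le S T \<and> formula_le T S"

lemma fequiv_trans: "formula_equiv S T \<Longrightarrow> formula_equiv T U \<Longrightarrow> formula_equiv S U"
  by (blast intro: fle_trans)

lemma fequiv_eq: "formula_eq S T \<Longrightarrow> formula_equiv S T"
  by (blast intro: fle_eq feq_sym)

section \<open>Substitution for the atom\<close>

text \<open>\<open>plug U S\<close> replaces the atom of \<open>S\<close> by \<open>U\<close>. It is meaningful if \<open>U\<close> is over the source of \<open>S\<close>.\<close>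

primrec plug :: "formula \<Rightarrow> formula \<Rightarrow> formula" where
  "plug U (Atom n) = U"
| "plug U (Sig n i S) = Sig n i (plug U S)"
| "plug U (Del n i S) = Del n i (plug U S)"

lemma source_plug [simp]: "source (plug U S) = source U"
  by (induction S) auto

lemma over_plug: "over S k \<Longrightarrow> over U (source S) \<Longrightarrow> over (plug U S) k"
  by (induction rule: over.induct) (auto intro: over.intros)

lemma formula_eq_plug:
  "formula_eq S T \<Longrightarrow> over U (source S) \<Longrightarrow> formula_eq (plug U S) (plug U T)"
proof (induction rule: formula_eq.induct)
  case (feq_sym S T)
  then show ?case using formula_eq_source formula_eq.feq_sym by metis
next
  case (feq_trans S T V)
  then show ?case using formula_eq_source formula_eq.feq_trans by metis
next
  case (feq_E1 S m i j)
  then show ?case using formula_eq.feq_E1[of "plug U S" m i j] by (auto intro: over_plug)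
next
  case (feq_E2 S m i j)
  then show ?case using formula_eq.feq_E2[of "plug U S" m i j] by (auto intro: over_plug)
qed (auto intro: formula_eq.intros over_plug)

lemma formula_le_plug:
  "formula_le S T \<Longrightarrow> over U (source S) \<Longrightarrow> formula_le (plug U S) (plug U T)"
proof (induction rule: formula_le.induct)
  case (fle_eq S T)
  then show ?case by (intro formula_le.fle_eq formula_eq_plug)
next
  case (fle_trans S T V)
  then show ?case using formula_le_source formula_le.fle_trans by metis
next
  case (fle_O1 S m i j)
  then show ?case using formula_le.fle_O1[of "plug U S" m i j] by (auto intro: over_plug)
next
  case (fle_O1' S m i j)
  then show ?case using formula_le.fle_O1'[of "plug U S" m i j] by (auto intro: over_plug)
next
  case (fle_O2 S m i j)
  then show ?case using formula_le.fle_O2[where S = "plug U S" and m = m] by (auto intro: over_plug)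
next
  case (fle_O3 S m i j)
  then show ?case using formula_le.fle_O3[where S = "plug U S" and m = m and i = i and j = j] by (auto intro: over_plug)
next
  case (fle_O3' S m i j)
  then show ?case using formula_le.fle_O3'[where S = "plug U S" and m = m and i = i and j = j] by (auto intro: over_plug)
qed (auto intro: formula_le.intros over_plug)

lemma plug_formula_le: "formula_le U V \<Longrightarrow> formula_le (plug U S) (plug V S)"
  by (induction S) (auto intro: formula_le.intros)


lemma label_plug:
  "over U (source S) \<Longrightarrow> label (plug U S) x = Option.bind (label U x) (label S)"
proof (induction S)
  case (Atom n)
  then show ?case by (cases "label U x") (auto dest: label_bounds)
qed (cases "label U x"; auto)+

lemma same_plug:
  "over U (source S) \<Longrightarrow> same (plug U S) x y \<longleftrightarrow> same U x y \<or>
     (\<exists>v w. label U x = Some v \<and> label U y = Some w \<and> same S v w)"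
proof (induction S)
  case (Atom n)
  then show ?case by (auto dest: same_if_label)
next
  case (Sig n i S)
  then show ?case by (auto simp: label_plug bind_eq_Some_conv)
qed auto

section \<open>The first generator of a formula\<close>

text \<open>\<open>front_sig j S\<close> and \<open>front_del j S\<close> insert $\sigma_j$ respectively $\delta_j$ as the first operation
  applied to the atom, which raises the source by one. On points they act as the map \<open>merge_at j\<close>
  and as the partial inverse of \<open>skip_at j\<close> put in front of \<open>S\<close>.\<close>

definition front_sig :: "nat \<Rightarrow> formula \<Rightarrow> formula" where
  "front_sig j S = plug (Sig (source S) j (Atom (source S + 1))) S"

definition front_del :: "nat \<Rightarrow> formula \<Rightarrow> formula" where
  "front_del j S = plug (Del (source S) j (Atom (source S + 1))) S"

lemma front_simps [simp]:
  "front_sig j (Sig n i S) = Sig n i (front_sig j S)"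
  "front_sig j (Del n i S) = Del n i (front_sig j S)"
  "front_del j (Sig n i S) = Sig n i (front_del j S)"
  "front_del j (Del n i S) = Del n i (front_del j S)"
  "source (front_sig j S) = Suc (source S)"
  "source (front_del j S) = Suc (source S)"
  by (auto simp: front_sig_def front_del_def)

lemma over_front_sig: "over S k \<Longrightarrow> j < source S \<Longrightarrow> over (front_sig j S) k"
  unfolding front_sig_def by (rule over_plug) (auto intro!: over.intros)

lemma over_front_del: "over S k \<Longrightarrow> j \<le> source S \<Longrightarrow> over (front_del j S) k"
  unfolding front_del_def by (rule over_plug) (auto intro!: over.intros)

lemma front_sig_mono: "formula_le S T \<Longrightarrow> j < source S \<Longrightarrow> formula_le (front_sig j S) (front_sig j T)"
  unfolding front_sig_def using formula_le_source[of S T]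
  by (auto intro!: formula_le_plug over.intros)

lemma front_del_mono: "formula_le S T \<Longrightarrow> j \<le> source S \<Longrightarrow> formula_le (front_del j S) (front_del j T)"
  unfolding front_del_def using formula_le_source[of S T]
  by (auto intro!: formula_le_plug over.intros)

lemma front_del_le_front_sig:
  "i = j \<or> i = j + 1 \<Longrightarrow> j < source S \<Longrightarrow> formula_le (front_del i S) (front_sig j S)"
  unfolding front_sig_def front_del_def
  by (intro plug_formula_le fle_O2) (auto intro!: over.intros)

lemma over_front_cases:
  assumes "over S k"
  obtains "S = Atom k"
    | S' j where "over S' k" "j < source S'" "S = front_sig j S'"
    | S' j where "over S' k" "j \<le> source S'" "S = front_del j S'"
proof -
  have "S = Atom k \<or> (\<exists>S' j. over S' k \<and> j < source S' \<and> S = front_sig j S')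
     \<or> (\<exists>S' j. over S' k \<and> j \<le> source S' \<and> S = front_del j S')"
    using assms
  proof (induction rule: over.induct)
    case (over_Sig S n i)
    then show ?case
    proof (elim disjE exE conjE)
      assume "S = Atom (n + 1)"
      then have "Sig n i S = front_sig i (Atom n)" by (simp add: front_sig_def)
      then show ?thesis using over_Sig by (metis over.over_Atom source.simps(1))
    qed (metis front_simps over.over_Sig source.simps over_Sig.hyps(2))+
  next
    case (over_Del S n i)
    then show ?case
    proof (elim disjE exE conjE)
      assume "S = Atom (n + 1)"
      then have "Del n i S = front_del i (Atom n)" by (simp add: front_del_def)
      then show ?thesis using over_Del by (metis over.over_Atom source.simps(1))
    qed (metis front_simps over.over_Del source.simps over_Del.hyps(2))+
  qed auto
  then show thesis using that by blast
qed

lemma over_le_source: "over S k \<Longrightarrow> k \<le> source S"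
  by (induction rule: over.induct) auto

lemma over_source_Atom: "over S (source S) \<Longrightarrow> S = Atom (source S)"
  by (erule over.cases) (auto dest: over_le_source)

lemma label_front_sig:
  "j < source S \<Longrightarrow> x \<le> source S \<Longrightarrow> label (front_sig j S) x = label S (merge_at j x)"
  unfolding front_sig_def by (subst label_plug) (auto intro!: over.intros)

lemma same_front_sig:
  "j < source S \<Longrightarrow> x \<le> source S \<Longrightarrow> y \<le> source S \<Longrightarrow>
    same (front_sig j S) x y \<longleftrightarrow> x = y \<or> merge_at j x = merge_at j y \<or> same S (merge_at j x) (merge_at j y)"
  unfolding front_sig_def by (subst same_plug) (auto intro!: over.intros)

lemma label_front_del_skip:
  "j \<le> source S \<Longrightarrow> x < source S \<Longrightarrow> label (front_del j S) (skip_at j x) = label S x"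
  unfolding front_del_def 
  by (subst label_plug) (auto intro!: over.intros simp: skip_at_def remove_at_def)

lemma label_front_del_self: "j \<le> source S \<Longrightarrow> label (front_del j S) j = None"
  unfolding front_del_def by (subst label_plug) (auto intro!: over.intros simp: remove_at_def)

lemma same_front_del_skip:
  "j \<le> source S \<Longrightarrow> x < source S \<Longrightarrow> y < source S \<Longrightarrow>
    same (front_del j S) (skip_at j x) (skip_at j y) \<longleftrightarrow> x = y \<or> same S x y"
  unfolding front_del_def
  by (subst same_plug) (auto intro!: over.intros simp: skip_at_def remove_at_def)

lemma same_front_del_self:
  "j \<le> source S \<Longrightarrow> same (front_del j S) j y \<longleftrightarrow> y = j"
  unfolding front_del_def by (subst same_plug) (auto intro!: over.intros simp: remove_at_def)

section \<open>Moving a generator to the front\<close>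

lemma fequiv_Sig: "formula_equiv S T \<Longrightarrow> formula_equiv (Sig n i S) (Sig n i T)"
  by (blast intro: fle_Sig)

lemma fequiv_Del: "formula_equiv S T \<Longrightarrow> formula_equiv (Del n i S) (Del n i T)"
  by (blast intro: fle_Del)

text \<open>The relations (E1), (E2), (O1) and (O3) as rules that carry a generator at position \<open>a\<close> inwards
  past a generator at position \<open>h\<close> below or above it. Read from right to left, \<open>Sig_Del_lower\<close> and
  \<open>Sig_Del_upper\<close> carry $\delta$ inwards past $\sigma$.\<close>

lemma Sig_Sig_lower:
  "over S (m + 2) \<Longrightarrow> h < a \<Longrightarrow> a \<le> m \<Longrightarrow>
    formula_equiv (Sig m (a - 1) (Sig (m + 1) h S)) (Sig m h (Sig (m + 1) a S))"
  using feq_sym[OF feq_E2[of S m h "a - 1"]] by (intro fequiv_eq) auto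

lemma Sig_Sig_upper:
  "over S (m + 2) \<Longrightarrow> a < h \<Longrightarrow> h \<le> m \<Longrightarrow>
    formula_equiv (Sig m a (Sig (m + 1) h S)) (Sig m (h - 1) (Sig (m + 1) a S))"
  using feq_E2[of S m a "h - 1"] by (intro fequiv_eq) auto

lemma Sig_Del_lower:
  "over S (m + 2) \<Longrightarrow> h < a \<Longrightarrow> a \<le> m \<Longrightarrow>
    formula_equiv (Sig m (a - 1) (Del (m + 1) h S)) (Del m h (Sig (m + 1) a S))"
  by (intro conjI fle_O1 fle_O1') auto

lemma Sig_Del_upper:
  "over S (m + 2) \<Longrightarrow> a + 1 < h \<Longrightarrow> h \<le> m + 1 \<Longrightarrow>
    formula_equiv (Sig m a (Del (m + 1) h S)) (Del m (h - 1) (Sig (m + 1) a S))"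
  by (intro conjI fle_O3 fle_O3') auto

lemma Del_Del_lower:
  "over S (m + 2) \<Longrightarrow> h < a \<Longrightarrow> a \<le> m + 1 \<Longrightarrow>
    formula_equiv (Del m (a - 1) (Del (m + 1) h S)) (Del m h (Del (m + 1) a S))"
  using feq_sym[OF feq_E1[of S m h "a - 1"]] by (intro fequiv_eq) auto

lemma Del_Del_upper:
  "over S (m + 2) \<Longrightarrow> a < h \<Longrightarrow> h \<le> m + 1 \<Longrightarrow>
    formula_equiv (Del m a (Del (m + 1) h S)) (Del m (h - 1) (Del (m + 1) a S))"
  using feq_E1[of S m a "h - 1"] by (intro fequiv_eq) auto

text \<open>If the outer $\sigma$ merges the blocks of the neighbours \<open>j\<close> and \<open>j + 1\<close>, then these blocks sit at
  neighbouring positions throughout \<open>S\<close>, and are neither closed nor merged with each other inside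
  \<open>S\<close>. Hence $\sigma$ can be carried past all generators of \<open>S\<close>.\<close>

lemma Sig_to_front:
  assumes "over S (m + 1)" "label S j = Some a" "label S (Suc j) = Some (Suc a)"
  shows "\<exists>T. over T m \<and> j < source T \<and> formula_equiv (Sig m a S) (front_sig j T)"
  using assms
proof (induction S arbitrary: m a)
  case (Atom n)
  then have "n = m + 1" "a = j" "j < m"
    by (auto elim: over.cases split: if_splits)
  then show ?case by (intro exI[of _ "Atom m"]) (auto simp: front_sig_def intro: over.intros fle_refl)
next
  case (Sig n h S)
  from Sig.prems have n: "n = m + 1" "h < m + 1" and S: "over S (m + 2)"
    by (auto simp: over_Sig_iff)
  obtain b c where b: "label S j = Some b" "merge_at h b = a"
    and c: "label S (Suc j) = Some c" "merge_at h c = Suc a"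
    using Sig.prems by auto
  have "b < c" using b c merge_at_mono[of c b h] by (cases "b < c") auto
  then have c_b: "c = Suc b" using label_consecutive S b c by blast
  have hb: "h \<noteq> b" using b c c_b by (auto simp: merge_at_def split: if_splits)
  have "c < m + 2" using label_bounds S c by blast
  with c_b have b_le: "b \<le> m" by simp
  obtain T where T: "over T (m + 1)" "j < source T"
    "formula_equiv (Sig (m + 1) b S) (front_sig j T)"
    using Sig.IH[of "m + 1" b] S b c c_b by auto
  show ?case
  proof (cases "h < b")
    case True
    then have a: "a = b - 1" using b by (simp add: merge_at_def)
    have "formula_equiv (Sig m a (Sig n h S)) (Sig m h (front_sig j T))"
      unfolding n a by (rule fequiv_trans[OF Sig_Sig_lower fequiv_Sig]) (use True S b_le T in auto)
    then show ?thesis using True b_le T by (intro exI[of _ "Sig m h T"]) (auto intro: over.intros)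
  next
    case False
    with hb have bh: "b < h" by simp
    then have a: "a = b" using b by (simp add: merge_at_def)
    have "formula_equiv (Sig m a (Sig n h S)) (Sig m (h - 1) (front_sig j T))"
      unfolding n a by (rule fequiv_trans[OF Sig_Sig_upper fequiv_Sig]) (use bh S n T in auto)
    then show ?thesis using bh n T by (intro exI[of _ "Sig m (h - 1) T"]) (auto intro: over.intros)
  qed
next
  case (Del n h S)
  from Del.prems have n: "n = m + 1" "h \<le> m + 1" and S: "over S (m + 2)"
    by (auto simp: over_Del_iff)
  obtain b c where b: "label S j = Some b" "b = skip_at h a"
    and c: "label S (Suc j) = Some c" "c = skip_at h (Suc a)"
    using Del.prems by (simp add: label_Del_eq_Some del: label.simps)
  then have "b < c" by simp
  then have c_b: "c = Suc b" using label_consecutive S b c by blast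
  then have "skip_at h (Suc a) = Suc (skip_at h a)" using b(2) c(2) by simp
  then have "h \<noteq> Suc a" by (auto simp: skip_at_def)
  then have hb: "h < b \<and> a = b - 1 \<or> b + 1 < h \<and> a = b"
    unfolding b(2) by (simp add: skip_at_def)
  have "c < m + 2" using label_bounds S c by blast
  with c_b have b_le: "b \<le> m" by simp
  obtain T where T: "over T (m + 1)" "j < source T"
    "formula_equiv (Sig (m + 1) b S) (front_sig j T)"
    using Del.IH[of "m + 1" b] S b c c_b by auto
  from hb show ?case
  proof (elim disjE conjE)
    assume h: "h < b" and a: "a = b - 1"
    have "formula_equiv (Sig m a (Del n h S)) (Del m h (front_sig j T))"
      unfolding n a by (rule fequiv_trans[OF Sig_Del_lower fequiv_Del]) (use h S b_le T in auto)
    then show ?thesis using h b_le T by (intro exI[of _ "Del m h T"]) (auto intro: over.intros)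
  next
    assume h: "b + 1 < h" and a: "a = b"
    have "formula_equiv (Sig m a (Del n h S)) (Del m (h - 1) (front_sig j T))"
      unfolding n a by (rule fequiv_trans[OF Sig_Del_upper fequiv_Del]) (use h S n T in auto)
    then show ?thesis using h n T by (intro exI[of _ "Del m (h - 1) T"]) (auto intro: over.intros)
  qed
qed

lemma adjacent_same_front_sig:
  assumes "over S k" "same S j (Suc j)"
  shows "\<exists>T. over T k \<and> j < source T \<and> formula_equiv S (front_sig j T)"
  using assms
proof (induction S arbitrary: k)
  case (Sig n i S)
  from Sig.prems have n: "k = n" "i < n" and S: "over S (n + 1)"
    by (auto simp: over_Sig_iff)
  show ?case
  proof (cases "same S j (Suc j)")
    case True
    then obtain T where "over T (n + 1)" "j < source T" "formula_equiv S (front_sig j T)"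
      using Sig.IH S by blast
    then show ?thesis using n by (intro exI[of _ "Sig n i T"]) (auto intro: over.intros fle_Sig)
  next
    case False
    then obtain v w where vw: "label S j = Some v" "label S (Suc j) = Some w" "merge_at i v = merge_at i w"
      using Sig.prems by auto
    have "v \<noteq> w" using vw False same_if_label by blast
    moreover have "v \<le> w" using vw label_mono by fastforce
    ultimately have "v < w" by simp
    then have "w = Suc v" using label_consecutive S vw by blast
    moreover from this have "v = i" using vw by (auto simp: merge_at_def split: if_splits)
    ultimately show ?thesis using Sig_to_front[of S n j i] S vw n by auto
  qed
next
  case (Del n i S)
  then obtain T where "over T (n + 1)" "j < source T" "formula_equiv S (front_sig j T)"
    by (auto simp: over_Del_iff)
  moreover have "k = n" "i \<le> n" using Del.prems by (auto simp: over_Del_iff)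
  ultimately show ?case by (intro exI[of _ "Del n i T"]) (auto intro: over.intros fle_Del)
qed auto

text \<open>If the outer $\delta$ closes the block \<open>{j}\<close>, then no $\sigma$ inside \<open>S\<close> involves its position, so $\delta$ can be
  carried past all generators of \<open>S\<close>.\<close>

lemma Del_to_front:
  assumes "over S (m + 1)" "label S j = Some a" "\<forall>y. same S j y \<longrightarrow> y = j"
  shows "\<exists>T. over T m \<and> j \<le> source T \<and> formula_equiv (Del m a S) (front_del j T)"
  using assms
proof (induction S arbitrary: m a)
  case (Atom n)
  then have "n = m + 1" "a = j" "j \<le> m"
    by (auto elim: over.cases split: if_splits)
  then show ?case by (intro exI[of _ "Atom m"]) (auto simp: front_del_def intro: over.intros fle_refl)
next
  case (Sig n h S)
  from Sig.prems have n: "n = m + 1" "h < m + 1" and S: "over S (m + 2)"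
    by (auto simp: over_Sig_iff)
  obtain b where b: "label S j = Some b" "merge_at h b = a"
    using Sig.prems by auto
  have b_le: "b < m + 2" using label_bounds S b by blast
  \<comment> \<open>Another block merged with that of \<open>j\<close> would be nonempty and put a second point into it.\<close>
  have inj: "c = b" if c: "c < m + 2" "merge_at h c = merge_at h b" for c
  proof -
    obtain y where "label S y = Some c" using label_surj S c by blast
    then show ?thesis using Sig.prems(3) b c by fastforce
  qed
  have hb: "h < b \<and> h + 1 \<noteq> b \<and> a = b - 1 \<or> b < h \<and> a = b"
    using inj[of h] inj[of "h + 1"] n b by (cases b h rule: linorder_cases) (auto simp: merge_at_def)
  obtain T where T: "over T (m + 1)" "j \<le> source T"
    "formula_equiv (Del (m + 1) b S) (front_del j T)"
    using Sig.IH[of "m + 1" b] S b Sig.prems(3) by auto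
  from hb show ?case
  proof (elim disjE conjE)
    assume h: "h < b" "h + 1 \<noteq> b" and a: "a = b - 1"
    have "formula_equiv (Del m a (Sig n h S)) (Sig m h (Del (m + 1) b S))"
      unfolding n a using Sig_Del_upper[of S m h b] S h b_le by auto
    then have "formula_equiv (Del m a (Sig n h S)) (Sig m h (front_del j T))"
      by (rule fequiv_trans[OF _ fequiv_Sig[OF T(3)]])
    then show ?thesis using h b_le T by (intro exI[of _ "Sig m h T"]) (auto intro: over.intros)
  next
    assume h: "b < h" and a: "a = b"
    have "formula_equiv (Del m a (Sig n h S)) (Sig m (h - 1) (Del (m + 1) b S))"
      unfolding n a using Sig_Del_lower[of S m b h] S h n by auto
    then have "formula_equiv (Del m a (Sig n h S)) (Sig m (h - 1) (front_del j T))"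
      by (rule fequiv_trans[OF _ fequiv_Sig[OF T(3)]])
    then show ?thesis using h n T by (intro exI[of _ "Sig m (h - 1) T"]) (auto intro: over.intros)
  qed
next
  case (Del n h S)
  from Del.prems have n: "n = m + 1" "h \<le> m + 1" and S: "over S (m + 2)"
    by (auto simp: over_Del_iff)
  obtain b where b: "label S j = Some b" "b = skip_at h a"
    using Del.prems by (simp add: label_Del_eq_Some del: label.simps)
  have b_le: "b < m + 2" using label_bounds S b by blast
  obtain T where T: "over T (m + 1)" "j \<le> source T"
    "formula_equiv (Del (m + 1) b S) (front_del j T)"
    using Del.IH[of "m + 1" b] S b Del.prems(3) by auto
  show ?case
  proof (cases "h < b")
    case True
    then have a: "a = b - 1" using b by (auto simp: skip_at_def split: if_splits)
    have "formula_equiv (Del m a (Del n h S)) (Del m h (front_del j T))"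
      unfolding n a by (rule fequiv_trans[OF Del_Del_lower fequiv_Del]) (use True S b_le T in auto)
    then show ?thesis using True b_le T by (intro exI[of _ "Del m h T"]) (auto intro: over.intros)
  next
    case False
    then have h: "b < h" and a: "a = b" using b by (auto simp: skip_at_def split: if_splits)
    have "formula_equiv (Del m a (Del n h S)) (Del m (h - 1) (front_del j T))"
      unfolding n a by (rule fequiv_trans[OF Del_Del_upper fequiv_Del]) (use h S n T in auto)
    then show ?thesis using h n T by (intro exI[of _ "Del m (h - 1) T"]) (auto intro: over.intros)
  qed
qed

lemma closed_singleton_front_del:
  assumes "over S k" "j < source S" "label S j = None" "\<forall>y. same S j y \<longrightarrow> y = j"
  shows "\<exists>T. over T k \<and> j \<le> source T \<and> formula_equiv S (front_del j T)"
  using assms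
proof (induction S arbitrary: k)
  case (Sig n i S)
  then obtain T where "over T (n + 1)" "j \<le> source T" "formula_equiv S (front_del j T)"
    by (auto simp: over_Sig_iff)
  moreover have "k = n" "i < n" using Sig.prems by (auto simp: over_Sig_iff)
  ultimately show ?case by (intro exI[of _ "Sig n i T"]) (auto intro: over.intros fle_Sig)
next
  case (Del n i S)
  from Del.prems have n: "k = n" "i \<le> n" and S: "over S (n + 1)"
    by (auto simp: over_Del_iff)
  show ?case
  proof (cases "label S j")
    case None
    then obtain T where "over T (n + 1)" "j \<le> source T" "formula_equiv S (front_del j T)"
      using Del S by auto
    then show ?thesis using n by (intro exI[of _ "Del n i T"]) (auto intro: over.intros fle_Del)
  next
    case (Some v)
    then have "v = i" using Del.prems by (auto simp: remove_at_def split: if_splits)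
    then show ?thesis using Del_to_front[of S n j i] S Some Del.prems n by auto
  qed
qed (auto split: if_splits)

section \<open>The preorder on formulas is the comparison of partitions and labels\<close>

text \<open>\<open>below S R g\<close>: the partition of \<open>S\<close> is finer than \<open>R\<close>, and the labelling of \<open>S\<close> is a restriction
  of \<open>g\<close>. Here \<open>R\<close> and \<open>g\<close> need not come from a formula, which lets inductions restrict them to
  fewer points.\<close>

definition below :: "formula \<Rightarrow> (nat \<Rightarrow> nat \<Rightarrow> bool) \<Rightarrow> (nat \<Rightarrow> nat option) \<Rightarrow> bool" where
  "below S R g \<longleftrightarrow> (\<forall>x y. same S x y \<longrightarrow> R x y) \<and> (\<forall>x v. label S x = Some v \<longrightarrow> g x = Some v)"

lemma commute_lower:
  assumes "i < j"
  shows "label (Sig m (j - 1) (Del (m + 1) i S)) = label (Del m i (Sig (m + 1) j S))"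
    and "same (Sig m (j - 1) (Del (m + 1) i S)) = same (Del m i (Sig (m + 1) j S))"
proof -
  have "map_option (merge_at (j - 1)) (remove_at i v) = remove_at i (merge_at j v)" for v
    using assms by (auto simp: merge_at_def remove_at_def)
  then show "label (Sig m (j - 1) (Del (m + 1) i S)) = label (Del m i (Sig (m + 1) j S))"
    by (simp add: fun_eq_iff split: option.split bind_split)
  show "same (Sig m (j - 1) (Del (m + 1) i S)) = same (Del m i (Sig (m + 1) j S))"
    using assms
    by (cases j) (simp_all add: fun_eq_iff same_Sig label_Del_eq_Some skip_at_def del: label.simps same.simps(2))
qed

lemma commute_upper:
  assumes "j + 1 < i"
  shows "label (Sig m j (Del (m + 1) i S)) = label (Del m (i - 1) (Sig (m + 1) j S))"
    and "same (Sig m j (Del (m + 1) i S)) = same (Del m (i - 1) (Sig (m + 1) j S))"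
proof -
  have "map_option (merge_at j) (remove_at i v) = remove_at (i - 1) (merge_at j v)" for v
    using assms by (auto simp: merge_at_def remove_at_def)
  then show "label (Sig m j (Del (m + 1) i S)) = label (Del m (i - 1) (Sig (m + 1) j S))"
    by (simp add: fun_eq_iff split: option.split bind_split)
  show "same (Sig m j (Del (m + 1) i S)) = same (Del m (i - 1) (Sig (m + 1) j S))"
    using assms
    by (simp add: fun_eq_iff same_Sig label_Del_eq_Some skip_at_def del: label.simps same.simps(2))
qed

lemma formula_le_below: "formula_le S T \<Longrightarrow> below S (same T) (label T)"
proof (induction rule: formula_le.induct)
  case (fle_eq S T)
  then show ?case using label_formula_eq same_formula_eq by (auto simp: below_def)
next
  case (fle_Sig S T n i)
  then show ?case unfolding below_def by (auto simp del: not_None_eq)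
next
  case (fle_Del S T n i)
  then show ?case by (auto simp: below_def bind_eq_Some_conv)
next
  case (fle_O1 S m i j)
  then show ?case using commute_lower[of i j m S] by (simp add: below_def)
next
  case (fle_O1' S m i j)
  then show ?case using commute_lower[of i j m S] by (simp add: below_def)
next
  case (fle_O2 S m i j)
  then have "merge_at j (skip_at i v) = v" for v
    by (auto simp: merge_at_def skip_at_def)
  then show ?case
    by (auto simp: below_def label_Del_eq_Some simp del: label.simps(3))
next
  case (fle_O3 S m i j)
  then show ?case using commute_upper[of j i m S] by (simp add: below_def)
next
  case (fle_O3' S m i j)
  then show ?case using commute_upper[of j i m S] by (simp add: below_def)
qed (auto simp: below_def)

lemma below_trans:
  "below S (same T) (label T) \<Longrightarrow> below T R g \<Longrightarrow> below S R g"
  by (auto simp: below_def)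

lemma merge_at_skip_at [simp]: "merge_at i (skip_at i x) = x"
  by (auto simp: merge_at_def skip_at_def)

lemma below_front_sigD:
  assumes "over S k" "i < source S" "below (front_sig i S) R g"
  shows "below S (\<lambda>x y. R (skip_at i x) (skip_at i y)) (\<lambda>x. g (skip_at i x))"
proof -
  have le: "skip_at i x \<le> source S" if "x < source S" for x
    using that by (auto simp: skip_at_def)
  have "R (skip_at i x) (skip_at i y)" if "same S x y" for x y
  proof -
    have "x < source S" "y < source S" using same_bounds that assms by blast+
    then have "same (front_sig i S) (skip_at i x) (skip_at i y)"
      using that assms by (simp add: same_front_sig le)
    then show ?thesis using assms(3) by (simp add: below_def)
  qed
  moreover have "g (skip_at i x) = Some v" if "label S x = Some v" for x v
  proof -
    have "x < source S" using label_bounds that assms by blast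
    then have "label (front_sig i S) (skip_at i x) = Some v"
      using that assms by (simp add: label_front_sig le)
    then show ?thesis using assms(3) by (simp add: below_def)
  qed
  ultimately show ?thesis by (simp add: below_def)
qed

lemma below_front_delD:
  assumes "over S k" "i \<le> source S" "below (front_del i S) R g"
  shows "below S (\<lambda>x y. R (skip_at i x) (skip_at i y)) (\<lambda>x. g (skip_at i x))"
proof -
  have "R (skip_at i x) (skip_at i y)" if "same S x y" for x y
    using that assms same_bounds[OF assms(1) that] same_front_del_skip[of i S x y]
    by (simp add: below_def)
  moreover have "g (skip_at i x) = Some v" if "label S x = Some v" for x v
    using that assms label_bounds[OF assms(1) that] label_front_del_skip[of i S x]
    by (simp add: below_def)
  ultimately show ?thesis by (simp add: below_def)
qed

text \<open>Both \<open>skip_at i\<close> and \<open>skip_at (Suc i)\<close> are sections of \<open>merge_at i\<close>; either may be used to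
  restrict \<open>R\<close> and \<open>g\<close>.\<close>

lemma below_front_sigI:
  assumes S: "over S k" "i < source S"
    and R: "symp R" "transp R" "\<forall>x y. R x y \<longrightarrow> g x = g y" "\<forall>x \<le> source S. R x x" "R i (Suc i)"
    and c: "c = i \<or> c = Suc i"
    and B: "below S (\<lambda>x y. R (skip_at c x) (skip_at c y)) (\<lambda>x. g (skip_at c x))"
  shows "below (front_sig i S) R g"
proof -
  have R_skip: "R (skip_at c (merge_at i x)) x" if "x \<le> source S" for x
  proof (cases "x = i \<or> x = Suc i")
    case True
    then have "skip_at c (merge_at i x) \<in> {i, Suc i}"
      using c by (auto simp: skip_at_def merge_at_def)
    then show ?thesis using True R S that by (auto dest: sympD)
  next
    case False
    then have "skip_at c (merge_at i x) = x"
      using c by (auto simp: skip_at_def merge_at_def)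
    then show ?thesis using R that by simp
  qed
  have over: "over (front_sig i S) k" using S over_front_sig by blast
  have lt: "merge_at i x < source S" if "x \<le> source S" for x
    using that S by (auto simp: merge_at_def)
  have "R x y" if xy: "same (front_sig i S) x y" for x y
  proof -
    have le: "x \<le> source S" "y \<le> source S" using same_bounds[OF over xy] by auto
    then have "same S (merge_at i x) (merge_at i y)"
      using xy S same_refl[OF lt[OF le(1)]] by (auto simp: same_front_sig)
    then have "R (skip_at c (merge_at i x)) (skip_at c (merge_at i y))"
      using B by (simp add: below_def)
    then show ?thesis using R_skip le R(1,2) by (meson sympD transpD)
  qed
  moreover have "g x = Some v" if xv: "label (front_sig i S) x = Some v" for x v
  proof -
    have le: "x \<le> source S" using label_bounds[OF over xv] by auto
    then have "label S (merge_at i x) = Some v" using xv S by (simp add: label_front_sig)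
    then have "g (skip_at c (merge_at i x)) = Some v" using B by (simp add: below_def)
    then show ?thesis using R_skip le R(3) by metis
  qed
  ultimately show ?thesis by (simp add: below_def)
qed

lemma skip_at_surj: "x \<noteq> i \<Longrightarrow> \<exists>y. x = skip_at i y"
  by (rule exI[of _ "if x < i then x else x - 1"]) (auto simp: skip_at_def)

lemma below_front_delI:
  assumes S: "over S k" "i \<le> source S" and R: "R i i"
    and B: "below S (\<lambda>x y. R (skip_at i x) (skip_at i y)) (\<lambda>x. g (skip_at i x))"
  shows "below (front_del i S) R g"
proof -
  have over: "over (front_del i S) k" using S over_front_del by blast
  have lt: "x < source S" if "skip_at i x \<le> source S" for x
    using that S by (auto simp: skip_at_def split: if_splits)
  have "R x y" if xy: "same (front_del i S) x y" for x y
  proof (cases "x = i \<or> y = i")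
    case True
    then show ?thesis using xy S R same_sym by (metis same_front_del_self)
  next
    case False
    then obtain a b where ab: "x = skip_at i a" "y = skip_at i b" using skip_at_surj by meson
    then have "a < source S" "b < source S" using same_bounds[OF over xy] lt by auto
    then have "same S a b" using xy S same_refl by (auto simp: ab same_front_del_skip)
    then show ?thesis using B by (simp add: below_def ab)
  qed
  moreover have "g x = Some v" if xv: "label (front_del i S) x = Some v" for x v
  proof -
    have "x \<noteq> i" using xv label_front_del_self S by auto
    then obtain a where a: "x = skip_at i a" using skip_at_surj by blast
    then have "a < source S" using label_bounds[OF over xv] lt by auto
    then have "label S a = Some v" using xv S by (simp add: a label_front_del_skip)
    then show ?thesis using B by (simp add: below_def a)
  qed
  ultimately show ?thesis by (simp add: below_def)
qed

lemma merge_at_adjacent: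
  "i \<noteq> j \<Longrightarrow> merge_at i (Suc j) = Suc (merge_at i j)"
  by (auto simp: merge_at_def)

text \<open>A formula below \<open>R\<close> and \<open>g\<close> can be raised to one that is still below them and in which two \<open>R\<close>-related
  neighbours share a block. The induction strips the first generator of \<open>S\<close>. The step in which
  something happens is a first generator that closes the singleton \<open>{j}\<close> or \<open>{j + 1}\<close>; (O2) trades it
  for $\sigma_j$. An atom is impossible, because it labels \<open>j\<close> and \<open>j + 1\<close> differently.\<close>

lemma below_join:
  assumes "over S k" "below S R g" "symp R" "transp R" "\<forall>x y. R x y \<longrightarrow> g x = g y"
    "R j (Suc j)" "Suc j < source S"
  shows "\<exists>T. formula_le S T \<and> below T R g \<and> same T j (Suc j)"
  using assms
proof (induction "source S" arbitrary: S j R g)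
  case 0
  then show ?case by simp
next
  case (Suc n)
  have refl: "R x x" if "x < source S" for x
    using that Suc.prems same_refl by (auto simp: below_def)
  show ?case using \<open>over S k\<close>
  proof (cases rule: over_front_cases)
    case 1
    then have "label S j = Some j" "label S (Suc j) = Some (Suc j)" using Suc.prems by auto
    then have "g j = Some j" "g (Suc j) = Some (Suc j)" using Suc.prems by (auto simp: below_def)
    then show ?thesis using Suc.prems by force
  next
    case (2 S' i)
    have i: "R i (Suc i)"
      using Suc.prems 2 by (auto simp: below_def same_front_sig merge_at_def)
    let ?R = "\<lambda>x y. R (skip_at i x) (skip_at i y)" and ?g = "\<lambda>x. g (skip_at i x)"
    show ?thesis
    proof (cases "i = j")
      case True
      then have "same S j (Suc j)" using 2 by (simp add: same_front_sig merge_at_def)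
      then show ?thesis using Suc.prems fle_refl by blast
    next
      case False
      have R_skip: "R (skip_at i (merge_at i x)) x" if "x < source S" for x
        using i refl that \<open>symp R\<close>
        by (cases "x = i") (auto simp: skip_at_def merge_at_def dest: sympD)
      have "R (skip_at i (merge_at i j)) (skip_at i (merge_at i (Suc j)))"
        using transpD[OF \<open>transp R\<close> transpD[OF \<open>transp R\<close> R_skip[of j] \<open>R j (Suc j)\<close>]
          sympD[OF \<open>symp R\<close> R_skip[of "Suc j"]]] \<open>Suc j < source S\<close> by simp
      then have "?R (merge_at i j) (Suc (merge_at i j))"
        using False by (simp add: merge_at_adjacent)
      moreover have "Suc (merge_at i j) < source S'"
        using False 2 Suc.prems by (auto simp: merge_at_def)
      moreover have "symp ?R" by (rule sympI) (rule sympD[OF \<open>symp R\<close>])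
      moreover have "transp ?R" by (rule transpI) (rule transpD[OF \<open>transp R\<close>])
      moreover have "below S' ?R ?g" using below_front_sigD 2 Suc.prems by blast
      ultimately obtain T where T: "formula_le S' T" "below T ?R ?g"
        "same T (merge_at i j) (Suc (merge_at i j))"
        using Suc.hyps(1)[of S' ?R ?g "merge_at i j"] 2 Suc.hyps(2) Suc.prems(5) by auto
      have src: "source T = source S'" using T formula_le_source by simp
      have "formula_le S (front_sig i T)" using T 2 front_sig_mono by simp
      moreover have "below (front_sig i T) R g"
        using below_front_sigI[of T k i R g i] T 2 src refl i Suc.prems formula_le_over by auto
      moreover have "same (front_sig i T) j (Suc j)"
        using T 2 src Suc.prems False by (simp add: same_front_sig merge_at_adjacent)
      ultimately show ?thesis by blast
    qed
  next
    case (3 S' i)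
    let ?R = "\<lambda>x y. R (skip_at i x) (skip_at i y)" and ?g = "\<lambda>x. g (skip_at i x)"
    have B: "below S' ?R ?g" using below_front_delD 3 Suc.prems by blast
    show ?thesis
    proof (cases "i = j \<or> i = Suc j")
      case True
      have "formula_le S (front_sig j S')"
        unfolding 3 by (rule front_del_le_front_sig) (use True 3 Suc.prems in auto)
      moreover have "below (front_sig j S') R g"
        using below_front_sigI[of S' k j R g i] B 3 True refl Suc.prems by auto
      moreover have "same (front_sig j S') j (Suc j)"
        using 3 Suc.prems by (simp add: same_front_sig merge_at_def)
      ultimately show ?thesis by blast
    next
      case False
      define a where "a = (if j < i then j else j - 1)"
      have a: "skip_at i a = j" "skip_at i (Suc a) = Suc j" "Suc a < source S'"
        using False 3 Suc.prems by (auto simp: a_def skip_at_def)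
      moreover have "symp ?R" by (rule sympI) (rule sympD[OF \<open>symp R\<close>])
      moreover have "transp ?R" by (rule transpI) (rule transpD[OF \<open>transp R\<close>])
      ultimately obtain T where T: "formula_le S' T" "below T ?R ?g" "same T a (Suc a)"
        using Suc.hyps(1)[of S' ?R ?g a] 3 Suc.hyps(2) Suc.prems B by auto
      have src: "source T = source S'" using T formula_le_source by simp
      have "formula_le S (front_del i T)" using T 3 front_del_mono by simp
      moreover have "below (front_del i T) R g"
        using below_front_delI[of T k i R g] T 3 src refl[of i] Suc.prems formula_le_over by auto
      moreover have "same (front_del i T) j (Suc j)"
        using T 3 src a same_front_del_skip[of i T a "Suc a"] by simp
      ultimately show ?thesis by blast
    qed
  qed
qed

text \<open>The induction follows the first generator of the larger formula \<open>T\<close>.\<close>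

lemma formula_le_complete:
  assumes "over S k" "over T k" "source S = source T" "below S (same T) (label T)"
  shows "formula_le S T"
  using assms
proof (induction "source T" arbitrary: S T rule: less_induct)
  case less
  show ?case using \<open>over T k\<close>
  proof (cases rule: over_front_cases)
    case 1
    then have "S = Atom k" using over_source_Atom less.prems by auto
    then show ?thesis using 1 fle_refl by simp
  next
    case (2 T' j)
    have "same T j (Suc j)" using 2 by (simp add: same_front_sig merge_at_def)
    moreover have "symp (same T)" "transp (same T)"
      by (auto simp: symp_def transp_def intro: same_sym same_trans)
    ultimately obtain S1 where S1: "formula_le S S1" "below S1 (same T) (label T)" "same S1 j (Suc j)"
      using below_join[of S k "same T" "label T" j] less.prems 2 same_label by auto
    have src1: "source S1 = source T" using S1 formula_le_source less.prems by metis
    obtain S' where S': "over S' k" "j < source S'" "formula_equiv S1 (front_sig j S')"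
      using adjacent_same_front_sig S1 less.prems formula_le_over by blast
    have src: "source S' = source T'" using S' src1 2 formula_le_source by fastforce
    have "below (front_sig j S') (same T) (label T)"
      using S' S1 formula_le_below below_trans by blast
    then have "below S' (\<lambda>x y. same T (skip_at j x) (skip_at j y)) (\<lambda>x. label T (skip_at j x))"
      using S' below_front_sigD by blast
    moreover have le: "skip_at j x \<le> source T'" if "x < source T'" for x
      using that by (auto simp: skip_at_def)
    have "same T (skip_at j x) (skip_at j y) \<longleftrightarrow> x = y \<or> same T' x y"
      if "x < source T'" "y < source T'" for x y
      using that le 2 by (simp add: same_front_sig)
    moreover have "label T (skip_at j x) = label T' x" if "x < source T'" for x
      using that le 2 by (simp add: label_front_sig)
    ultimately have "below S' (same T') (label T')"
      using same_bounds[OF S'(1)] label_bounds[OF S'(1)] same_refl src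
      unfolding below_def by metis
    then have "formula_le S' T'" using less.hyps[of T' S'] S' 2 src by simp
    then have "formula_le (front_sig j S') T" using 2 front_sig_mono S' by simp
    then show ?thesis using S1 S' fle_trans by blast
  next
    case (3 T' j)
    have "label S j = None"
      using 3 less.prems label_front_del_self[of j T'] by (cases "label S j") (auto simp: below_def)
    moreover have "\<forall>y. same S j y \<longrightarrow> y = j"
      using 3 less.prems same_front_del_self[of j T'] by (auto simp: below_def)
    ultimately obtain S' where S': "over S' k" "j \<le> source S'" "formula_equiv S (front_del j S')"
      using closed_singleton_front_del[of S k j] less.prems 3 by auto
    have src: "source S' = source T'" using S' less.prems 3 formula_le_source by fastforce
    have "below (front_del j S') (same T) (label T)"
      using S' less.prems formula_le_below below_trans by blast
    then have "below S' (\<lambda>x y. same T (skip_at j x) (skip_at j y)) (\<lambda>x. label T (skip_at j x))"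
      using S' below_front_delD by blast
    then have "below S' (same T') (label T')"
      using same_bounds[OF S'(1)] label_bounds[OF S'(1)] same_refl[of _ T'] src 3(2)
        same_front_del_skip[of j T'] label_front_del_skip[of j T']
      unfolding below_def 3(3) by metis
    then have "formula_le S' T'" using less.hyps[of T' S'] S' 3 src by simp
    then have "formula_le (front_del j S') T" using 3 front_del_mono S' by simp
    then show ?thesis using S' fle_trans by blast
  qed
qed

section \<open>Arrows of the simplex category\<close>

lemma Delta_homD:
  assumes "f \<in> Delta_hom m n"
  shows "x < m \<Longrightarrow> f x < n" "\<not> x < m \<Longrightarrow> f x = undefined"
    "x \<le> y \<Longrightarrow> y < m \<Longrightarrow> f x \<le> f y"
  using assms unfolding Delta_hom_def
  by (auto simp: PiE_iff extensional_def mono_on_def)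

lemma Delta_homI:
  assumes "\<And>x. x < m \<Longrightarrow> f x < n" "\<And>x. \<not> x < m \<Longrightarrow> f x = undefined"
    "\<And>x y. x \<le> y \<Longrightarrow> y < m \<Longrightarrow> f x \<le> f y"
  shows "f \<in> Delta_hom m n"
  using assms unfolding Delta_hom_def
  by (auto simp: PiE_iff extensional_def mono_on_def)

lemma Delta_hom_eqI:
  assumes "f \<in> Delta_hom m n" "g \<in> Delta_hom m n'" "\<And>x. x < m \<Longrightarrow> f x = g x"
  shows "f = g"
proof
  show "f x = g x" for x
    using assms Delta_homD(2) by (cases "x < m") metis+
qed

lemma Delta_comp_apply [simp]: "x < m \<Longrightarrow> Delta_comp m f g x = g (f x)"
  by (simp add: Delta_comp_def compose_def)

lemma Delta_comp_hom:
  assumes "f \<in> Delta_hom m n" "g \<in> Delta_hom n p"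
  shows "Delta_comp m f g \<in> Delta_hom m p"
proof (rule Delta_homI)
  show "Delta_comp m f g x = undefined" if "\<not> x < m" for x
    using that by (simp add: Delta_comp_def compose_def)
  show "Delta_comp m f g x \<le> Delta_comp m f g y" if "x \<le> y" "y < m" for x y
    using that assms by (simp add: Delta_homD)
qed (use assms in \<open>simp add: Delta_homD\<close>)

lemma Delta_comp_cong:
  "(\<And>x. x < m \<Longrightarrow> g (f x) = g' (f' x)) \<Longrightarrow> Delta_comp m f g = Delta_comp m f' g'"
  by (auto simp: Delta_comp_def compose_def restrict_def)

lemma Delta_comp_eqD: "Delta_comp m f g = Delta_comp m f' g' \<Longrightarrow> x < m \<Longrightarrow> g (f x) = g' (f' x)"
  by (metis Delta_comp_apply)

lemma Delta_comp_assoc: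
  assumes "f \<in> Delta_hom m n"
  shows "Delta_comp m (Delta_comp m f g) h = Delta_comp m f (Delta_comp n g h)"
  by (rule Delta_comp_cong) (use assms in \<open>simp add: Delta_homD\<close>)

lemma Delta_id_hom [simp]: "Delta_id m \<in> Delta_hom m m"
  by (rule Delta_homI) (auto simp: Delta_id_def)

lemma Delta_id_apply [simp]: "x < m \<Longrightarrow> Delta_id m x = x"
  by (simp add: Delta_id_def)

lemma sigma_apply [simp]: "x \<le> n \<Longrightarrow> sigma n i x = merge_at i x"
  by (simp add: sigma_def merge_at_def)

lemma delta_apply [simp]: "x < n \<Longrightarrow> delta n i x = skip_at i x"
  by (simp add: delta_def skip_at_def)

lemma sigma_hom: "i < n \<Longrightarrow> sigma n i \<in> Delta_hom (Suc n) n"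
  by (rule Delta_homI) (auto simp: sigma_def)

lemma delta_hom: "delta n i \<in> Delta_hom n (Suc n)"
  by (rule Delta_homI) (auto simp: delta_def)

lemma Delta_hom_bij_id:
  assumes "f \<in> Delta_hom k l" "inj_on f {..<k}" "f ` {..<k} = {..<l}"
  shows "k = l" "f = Delta_id k"
proof -
  show "k = l"
    using assms by (metis card_image card_lessThan)
  have less: "f x < f y" if "x < y" "y < k" for x y
    using that assms Delta_homD(3)[OF assms(1), of x y]
    by (metis inj_onD lessThan_iff less_trans le_neq_implies_less less_imp_le_nat nat_neq_iff)
  have ge: "x \<le> f x" if "x < k" for x
    using that
  proof (induction x)
    case (Suc x)
    then show ?case using less[of x "Suc x"] by simp
  qed simp
  have "f x = x" if "x < k" for x
    using that
  proof (induction x rule: less_induct)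
    case (less x)
    then obtain z where z: "z < k" "f z = x" using assms(3) \<open>k = l\<close>
      by (metis (no_types, lifting) imageE lessThan_iff)
    then have "x \<le> z" using less.IH[of z] by (cases "z < x") auto
    then have "f x \<le> x" using z Delta_homD(3)[OF assms(1)] by blast
    then show ?case using ge less.prems by (simp add: le_antisym)
  qed
  then show "f = Delta_id k"
    by (intro Delta_hom_eqI[OF assms(1) Delta_id_hom]) simp
qed

lemma Delta_epi_iff: "Delta_epi m n e \<longleftrightarrow> e \<in> Delta_hom m n \<and> e ` {..<m} = {..<n}"
proof safe
  assume e: "Delta_epi m n e"
  then show hom: "e \<in> Delta_hom m n" by (simp add: Delta_epi_def)
  show "e x < n" if "x < m" for x using Delta_homD(1) hom that by blast
  show "v \<in> e ` {..<m}" if "v < n" for v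
  proof (rule ccontr)
    assume v: "v \<notin> e ` {..<m}"
    \<comment> \<open>Two maps that differ only at \<open>v\<close>.\<close>
    define f where "f = restrict (\<lambda>w. if w < v then 0 else Suc 0) {..<n}"
    define g where "g = restrict (\<lambda>w. if w \<le> v then 0 else Suc 0) {..<n}"
    have "f \<in> Delta_hom n 2" "g \<in> Delta_hom n 2"
      by (auto intro!: Delta_homI simp: f_def g_def)
    moreover have "Delta_comp m e f = Delta_comp m e g"
      by (rule Delta_comp_cong)
        (use v hom in \<open>auto simp: f_def g_def Delta_homD image_iff order_le_less\<close>)
    ultimately have "f = g" using e unfolding Delta_epi_def by blast
    then have "f v = g v" by simp
    then show False using that by (simp add: f_def g_def)
  qed
next
  assume hom: "e \<in> Delta_hom m n" and im: "e ` {..<m} = {..<n}"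
  show "Delta_epi m n e"
    unfolding Delta_epi_def
  proof (intro conjI allI ballI impI hom)
    fix p f g
    assume fg: "f \<in> Delta_hom n p" "g \<in> Delta_hom n p" and eq: "Delta_comp m e f = Delta_comp m e g"
    show "f = g"
    proof (rule Delta_hom_eqI[OF fg])
      fix x assume "x < n"
      then obtain u where "u < m" "e u = x" using im by (metis imageE lessThan_iff)
      then show "f x = g x" using Delta_comp_eqD[OF eq, of u] by simp
    qed
  qed
qed

lemma Delta_mono_iff: "Delta_mono m n d \<longleftrightarrow> d \<in> Delta_hom m n \<and> inj_on d {..<m}"
proof (intro iffI conjI)
  assume d: "Delta_mono m n d"
  then show hom: "d \<in> Delta_hom m n" by (simp add: Delta_mono_def)
  show "inj_on d {..<m}"
  proof (rule inj_onI)
    fix x y assume "x \<in> {..<m}" "y \<in> {..<m}" "d x = d y"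
    define f where "f z = restrict (\<lambda>_. z) {..<Suc 0}" for z :: nat
    have "f x \<in> Delta_hom 1 m" "f y \<in> Delta_hom 1 m"
      using \<open>x \<in> _\<close> \<open>y \<in> _\<close> by (auto intro!: Delta_homI simp: f_def split: if_splits)
    moreover have "Delta_comp 1 (f x) d = Delta_comp 1 (f y) d"
      by (rule Delta_comp_cong) (use \<open>d x = d y\<close> in \<open>simp add: f_def\<close>)
    ultimately have "f x = f y" using d unfolding Delta_mono_def by blast
    then have "f x 0 = f y 0" by simp
    then show "x = y" by (simp add: f_def)
  qed
next
  assume d: "d \<in> Delta_hom m n \<and> inj_on d {..<m}"
  show "Delta_mono m n d"
    unfolding Delta_mono_def
  proof (intro conjI allI ballI impI)
    fix p f g
    assume fg: "f \<in> Delta_hom p m" "g \<in> Delta_hom p m" and eq: "Delta_comp p f d = Delta_comp p g d"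
    show "f = g"
    proof (rule Delta_hom_eqI[OF fg])
      fix x assume "x < p"
      then show "f x = g x" using Delta_comp_eqD[OF eq, of x] d fg
        by (metis Delta_homD(1) inj_onD lessThan_iff)
    qed
  qed (use d in simp)
qed

lemma sigma_epi: "i < n \<Longrightarrow> Delta_epi (Suc n) n (sigma n i)"
  unfolding Delta_epi_iff
proof (intro conjI sigma_hom subset_antisym subsetI)
  fix v assume i: "i < n"
  show "v \<in> {..<n}" if "v \<in> sigma n i ` {..<Suc n}"
    using that sigma_hom[OF i] by (auto dest: Delta_homD(1))
  show "v \<in> sigma n i ` {..<Suc n}" if "v \<in> {..<n}"
    using that by (intro image_eqI[of _ _ "skip_at i v"]) (auto simp: skip_at_def merge_at_def)
qed

lemma delta_mono: "Delta_mono n (Suc n) (delta n i)"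
  unfolding Delta_mono_iff by (auto intro!: delta_hom inj_onI)

section \<open>Bicartesian squares\<close>

text \<open>For monos \<open>a\<close> and epis \<open>b\<close>, \<open>c\<close>, a square is bicartesian if it is a pullback of sets and \<open>b\<close>
  identifies only what \<open>c\<close> forces it to identify. The induced maps are monotone because \<open>a\<close>
  reflects the order and because \<open>b\<close> is a monotone surjection.\<close>

lemma bicartesian_squareI:
  assumes a: "Delta_mono p q a" and b: "Delta_epi q s b" and c: "Delta_epi p r c"
    and d: "d \<in> Delta_hom r s"
    and comm: "\<And>t. t < p \<Longrightarrow> b (a t) = d (c t)"
    and pb: "\<And>u v. u < q \<Longrightarrow> v < r \<Longrightarrow> b u = d v \<Longrightarrow> \<exists>t<p. a t = u \<and> c t = v"
    and po: "\<And>u u'. u < q \<Longrightarrow> u' < q \<Longrightarrow> b u = b u' \<Longrightarrow>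
      u = u' \<or> (\<exists>t<p. \<exists>t'<p. a t = u \<and> a t' = u' \<and> c t = c t')"
  shows "bicartesian_square p q r s a b c d"
proof -
  have a': "a \<in> Delta_hom p q" "inj_on a {..<p}" and b': "b \<in> Delta_hom q s" "b ` {..<q} = {..<s}"
    and c': "c \<in> Delta_hom p r" "c ` {..<p} = {..<r}"
    using a b c by (auto simp: Delta_mono_iff Delta_epi_iff)
  have sq: "commuting_square p q r s a b c d"
    unfolding commuting_square_def using a' b' c' d comm by (auto intro: Delta_comp_cong)
  have "\<exists>!h. h \<in> Delta_hom x p \<and> Delta_comp x h a = f \<and> Delta_comp x h c = g"
    if f: "f \<in> Delta_hom x q" and g: "g \<in> Delta_hom x r" and fg: "Delta_comp x f b = Delta_comp x g d"
    for x f g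
  proof (rule ex_ex1I)
    have "\<exists>t<p. a t = f w \<and> c t = g w" if "w < x" for w
      using pb Delta_comp_eqD[OF fg that] that f g by (simp add: Delta_homD)
    then obtain h0 where h0: "\<And>w. w < x \<Longrightarrow> h0 w < p \<and> a (h0 w) = f w \<and> c (h0 w) = g w"
      by metis
    define h where "h = restrict h0 {..<x}"
    have h: "h w < p" "a (h w) = f w" "c (h w) = g w" if "w < x" for w
      using h0 that by (auto simp: h_def)
    have "h w \<le> h w'" if w: "w \<le> w'" "w' < x" for w w'
    proof (rule ccontr)
      assume "\<not> h w \<le> h w'"
      then have "a (h w') \<le> a (h w)" using w h(1)[of w] Delta_homD(3)[OF a'(1)] by simp
      moreover have "a (h w) \<le> a (h w')" using w h(2) f by (simp add: Delta_homD)
      ultimately have "h w = h w'"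
        using inj_onD[OF a'(2), of "h w" "h w'"] h(1) w by simp
      then show False using \<open>\<not> h w \<le> h w'\<close> by simp
    qed
    then have "h \<in> Delta_hom x p" using h by (intro Delta_homI) (auto simp: h_def)
    moreover have "Delta_comp x h a = f"
      by (rule Delta_hom_eqI[OF Delta_comp_hom[OF \<open>h \<in> _\<close> a'(1)] f]) (simp add: h)
    moreover have "Delta_comp x h c = g"
      by (rule Delta_hom_eqI[OF Delta_comp_hom[OF \<open>h \<in> _\<close> c'(1)] g]) (simp add: h)
    ultimately show "\<exists>h. h \<in> Delta_hom x p \<and> Delta_comp x h a = f \<and> Delta_comp x h c = g" by blast
  next
    show "h = h'" if "h \<in> Delta_hom x p \<and> Delta_comp x h a = f \<and> Delta_comp x h c = g"
      "h' \<in> Delta_hom x p \<and> Delta_comp x h' a = f \<and> Delta_comp x h' c = g" for h h'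
      using that a unfolding Delta_mono_def by blast
  qed
  moreover have "\<exists>!h. h \<in> Delta_hom s x \<and> Delta_comp q b h = f \<and> Delta_comp r d h = g"
    if f: "f \<in> Delta_hom q x" and g: "g \<in> Delta_hom r x" and fg: "Delta_comp p a f = Delta_comp p c g"
    for x f g
  proof (rule ex_ex1I)
    have fb: "f u = f u'" if "u < q" "u' < q" "b u = b u'" for u u'
      using po[OF that] Delta_comp_eqD[OF fg] by metis
    have "\<exists>u<q. b u = y" if "y < s" for y
      using b'(2) that by (metis imageE lessThan_iff)
    then obtain k where k: "\<And>y. y < s \<Longrightarrow> k y < q \<and> b (k y) = y" by metis
    define h where "h = restrict (\<lambda>y. f (k y)) {..<s}"
    have hb: "h (b u) = f u" if "u < q" for u
    proof -
      have "b u < s" using b'(1) that by (simp add: Delta_homD)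
      then show ?thesis using k[of "b u"] fb[of "k (b u)" u] that by (simp add: h_def)
    qed
    have "h y \<le> h y'" if y: "y \<le> y'" "y' < s" for y y'
    proof (cases "k y \<le> k y'")
      case True
      then show ?thesis using y k[of y'] Delta_homD(3)[OF f] by (simp add: h_def)
    next
      case False
      then have "y' \<le> y" using k[of y] k[of y'] y Delta_homD(3)[OF b'(1), of "k y'" "k y"] by simp
      then show ?thesis using y by simp
    qed
    then have h: "h \<in> Delta_hom s x"
      using k f by (intro Delta_homI) (auto simp: h_def Delta_homD)
    moreover have "Delta_comp q b h = f"
      by (rule Delta_hom_eqI[OF Delta_comp_hom[OF b'(1) h] f]) (simp add: hb)
    moreover have "Delta_comp r d h = g"
    proof (rule Delta_hom_eqI[OF Delta_comp_hom[OF d h] g])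
      fix v assume v: "v < r"
      then obtain t where t: "t < p" "c t = v" using c'(2) by (metis imageE lessThan_iff)
      then show "Delta_comp r d h v = g v"
        using v comm[of t] hb[of "a t"] a'(1) Delta_comp_eqD[OF fg, of t] by (simp add: Delta_homD)
    qed
    ultimately show "\<exists>h. h \<in> Delta_hom s x \<and> Delta_comp q b h = f \<and> Delta_comp r d h = g" by blast
  next
    show "h = h'" if "h \<in> Delta_hom s x \<and> Delta_comp q b h = f \<and> Delta_comp r d h = g"
      "h' \<in> Delta_hom s x \<and> Delta_comp q b h' = f \<and> Delta_comp r d h' = g" for h h'
      using that b unfolding Delta_epi_def by blast
  qed
  ultimately show ?thesis
    using sq by (simp add: bicartesian_square_def pullback_square_def pushout_square_def)
qed

text \<open>Conversely, the pullback property is tested on maps from the ordinal \<open>1\<close>. For the second claim,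
  suppose \<open>b\<close> identified two elements \<open>u < u'\<close> with value \<open>w\<close> outside the image of \<open>d\<close>. Doubling \<open>w\<close>
  in the codomain of \<open>b\<close> gives compatible maps that separate \<open>u\<close> from \<open>u'\<close>, contradicting the
  pushout property.\<close>
lemma
  assumes sq: "bicartesian_square p q r s a b c d"
  shows bicartesian_pullback: "u < q \<Longrightarrow> v < r \<Longrightarrow> b u = d v \<Longrightarrow> \<exists>t<p. a t = u \<and> c t = v"
    and bicartesian_pushout: "u < q \<Longrightarrow> u' < q \<Longrightarrow> b u = b u' \<Longrightarrow>
      u = u' \<or> (\<exists>t<p. \<exists>t'<p. a t = u \<and> a t' = u' \<and> c t = c t')"
proof -
  from sq have pb: "pullback_square p q r s a b c d" and po: "pushout_square p q r s a b c d"
    and cs: "commuting_square p q r s a b c d"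
    by (auto simp: bicartesian_square_def pullback_square_def)
  then have hom: "a \<in> Delta_hom p q" "b \<in> Delta_hom q s" "c \<in> Delta_hom p r" "d \<in> Delta_hom r s"
    and comm: "Delta_comp p a b = Delta_comp p c d"
    by (auto simp: commuting_square_def)
  show *: "\<exists>t<p. a t = u \<and> c t = v" if uv: "u < q" "v < r" "b u = d v" for u v
  proof -
    define f where "f z = restrict (\<lambda>_. z) {..<Suc 0}" for z :: nat
    have fg: "f u \<in> Delta_hom 1 q" "f v \<in> Delta_hom 1 r"
      using uv by (auto intro!: Delta_homI simp: f_def split: if_splits)
    moreover have "Delta_comp 1 (f u) b = Delta_comp 1 (f v) d"
      by (rule Delta_comp_cong) (use uv in \<open>simp add: f_def\<close>)
    ultimately obtain h where h: "h \<in> Delta_hom 1 p" "Delta_comp 1 h a = f u" "Delta_comp 1 h c = f v"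
      using pb unfolding pullback_square_def by blast
    from h(2,3) have "Delta_comp 1 h a 0 = f u 0" "Delta_comp 1 h c 0 = f v 0" by simp_all
    then have "a (h 0) = u" "c (h 0) = v" by (simp_all add: f_def)
    moreover have "h 0 < p" using h(1) by (simp add: Delta_homD)
    ultimately show ?thesis by blast
  qed
  have po_less: "\<exists>t<p. \<exists>t'<p. a t = u \<and> a t' = u' \<and> c t = c t'"
    if u: "u < u'" "u' < q" "b u = b u'" for u u'
  proof (cases "\<exists>v<r. b u = d v")
    case True
    then obtain v where "v < r" "b u = d v" by blast
    then show ?thesis using *[of u v] *[of u' v] u by (metis less_trans)
  next
    case False
    define w where "w = b u"
    define f where "f = restrict (\<lambda>z. if b z < w \<or> b z = w \<and> z \<le> u then b z else Suc (b z)) {..<q}"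
    define g where "g = restrict (\<lambda>v. if d v < w then d v else Suc (d v)) {..<r}"
    have f: "f \<in> Delta_hom q (Suc s)"
    proof (rule Delta_homI)
      fix y z assume yz: "y \<le> z" "z < q"
      then have "b y \<le> b z" using hom(2) by (simp add: Delta_homD)
      then show "f y \<le> f z" using yz by (auto simp: f_def)
    next
      show "f z < Suc s" if "z < q" for z
        using Delta_homD(1)[OF hom(2) that] that by (auto simp: f_def)
    qed (simp add: f_def)
    have g: "g \<in> Delta_hom r (Suc s)"
    proof (rule Delta_homI)
      fix y z assume yz: "y \<le> z" "z < r"
      then have "d y \<le> d z" using hom(4) by (simp add: Delta_homD)
      then show "g y \<le> g z" using yz by (auto simp: g_def)
    next
      show "g z < Suc s" if "z < r" for z
        using Delta_homD(1)[OF hom(4) that] that by (auto simp: g_def)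
    qed (simp add: g_def)
    have "Delta_comp p a f = Delta_comp p c g"
    proof (rule Delta_comp_cong)
      fix t assume t: "t < p"
      then have "a t < q" "c t < r" "b (a t) = d (c t)"
        using Delta_homD(1)[OF hom(1) t] Delta_homD(1)[OF hom(3) t] Delta_comp_eqD[OF comm t] by auto
      moreover from this have "b (a t) \<noteq> w" using False by (auto simp: w_def)
      ultimately show "f (a t) = g (c t)" by (auto simp: f_def g_def)
    qed
    then obtain h where "Delta_comp q b h = f" using po f g unfolding pushout_square_def by blast
    then have "f u = h (b u)" "f u' = h (b u')" using u by auto
    then have "f u = f u'" using u by simp
    then show ?thesis using u by (simp add: f_def w_def)
  qed
  show "u = u' \<or> (\<exists>t<p. \<exists>t'<p. a t = u \<and> a t' = u' \<and> c t = c t')"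
    if "u < q" "u' < q" "b u = b u'" for u u'
    using po_less[of u u'] po_less[of u' u] that by (metis nat_neq_iff)
qed

lemma bicartesian_sigma_delta_lower:
  assumes "i < j" "j \<le> m"
  shows "bicartesian_square (Suc m) (Suc (Suc m)) m (Suc m)
    (delta (Suc m) i) (sigma (Suc m) j) (sigma m (j - 1)) (delta m i)"
proof (rule bicartesian_squareI)
  have "\<exists>t<Suc m. skip_at i t = u \<and> merge_at (j - 1) t = v"
    if "u \<le> Suc m" "v < m" "merge_at j u = skip_at i v" for u v
    by (rule exI[of _ "if u < i then u else u - 1"])
      (use that assms in \<open>auto simp: skip_at_def merge_at_def split: if_splits\<close>)
  then show "\<exists>t<Suc m. delta (Suc m) i t = u \<and> sigma m (j - 1) t = v"
    if "u < Suc (Suc m)" "v < m" "sigma (Suc m) j u = delta m i v" for u v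
    using that by (metis delta_apply sigma_apply less_Suc_eq_le)
  show "u = u' \<or> (\<exists>t<Suc m. \<exists>t'<Suc m. delta (Suc m) i t = u \<and> delta (Suc m) i t' = u' \<and>
      sigma m (j - 1) t = sigma m (j - 1) t')"
    if u: "u < Suc (Suc m)" "u' < Suc (Suc m)" "sigma (Suc m) j u = sigma (Suc m) j u'" for u u'
  proof (cases "u = u'")
    case False
    then have "u = j \<and> u' = Suc j \<or> u = Suc j \<and> u' = j"
      using u by (simp add: merge_at_eq_iff)
    moreover have "delta (Suc m) i (j - 1) = j" "delta (Suc m) i j = Suc j"
      "sigma m (j - 1) (j - 1) = sigma m (j - 1) j" "(j - 1) < Suc m" "j < Suc m"
      using assms by (auto simp: skip_at_def merge_at_def)
    ultimately show ?thesis by metis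
  qed simp
  show "sigma (Suc m) j (delta (Suc m) i t) = delta m i (sigma m (j - 1) t)" if "t < Suc m" for t
  proof -
    have "merge_at (j - 1) t < m" "skip_at i t \<le> Suc m"
      using that assms by (auto simp: merge_at_def skip_at_def)
    then show ?thesis using that assms by (auto simp: merge_at_def skip_at_def)
  qed
qed (use assms in \<open>auto intro: delta_mono delta_hom sigma_epi\<close>)

lemma bicartesian_sigma_delta_upper:
  assumes "j + 1 < i" "i \<le> Suc m"
  shows "bicartesian_square (Suc m) (Suc (Suc m)) m (Suc m)
    (delta (Suc m) i) (sigma (Suc m) j) (sigma m j) (delta m (i - 1))"
proof (rule bicartesian_squareI)
  have "\<exists>t<Suc m. skip_at i t = u \<and> merge_at j t = v"
    if "u \<le> Suc m" "v < m" "merge_at j u = skip_at (i - 1) v" for u v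
    by (rule exI[of _ "if u < i then u else u - 1"])
      (use that assms in \<open>auto simp: skip_at_def merge_at_def split: if_splits\<close>)
  then show "\<exists>t<Suc m. delta (Suc m) i t = u \<and> sigma m j t = v"
    if "u < Suc (Suc m)" "v < m" "sigma (Suc m) j u = delta m (i - 1) v" for u v
    using that by (metis delta_apply sigma_apply less_Suc_eq_le)
  show "u = u' \<or> (\<exists>t<Suc m. \<exists>t'<Suc m. delta (Suc m) i t = u \<and> delta (Suc m) i t' = u' \<and>
      sigma m j t = sigma m j t')"
    if u: "u < Suc (Suc m)" "u' < Suc (Suc m)" "sigma (Suc m) j u = sigma (Suc m) j u'" for u u'
  proof (cases "u = u'")
    case False
    then have "u = j \<and> u' = Suc j \<or> u = Suc j \<and> u' = j"
      using u by (simp add: merge_at_eq_iff)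
    moreover have "delta (Suc m) i j = j" "delta (Suc m) i (Suc j) = Suc j"
      "sigma m j j = sigma m j (Suc j)" "j < Suc m" "(Suc j) < Suc m"
      using assms by (auto simp: skip_at_def merge_at_def)
    ultimately show ?thesis by metis
  qed simp
  show "sigma (Suc m) j (delta (Suc m) i t) = delta m (i - 1) (sigma m j t)" if "t < Suc m" for t
  proof -
    have "merge_at j t < m" "skip_at i t \<le> Suc m"
      using that assms by (auto simp: merge_at_def skip_at_def)
    then show ?thesis using that assms by (auto simp: merge_at_def skip_at_def)
  qed
qed (use assms in \<open>auto intro: delta_mono delta_hom sigma_epi\<close>)

section \<open>Classes of formulas\<close>

text \<open>The outcome of a formula depends only on its class.\<close>

lift_definition class_label :: "fclass \<Rightarrow> nat \<Rightarrow> nat option" is label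
  by (rule label_formula_eq)

lift_definition class_same :: "fclass \<Rightarrow> nat \<Rightarrow> nat \<Rightarrow> bool" is same
  by (rule same_formula_eq)

lemma class_label_sig [simp]:
  "class_label (sig_plus n i x) p = map_option (merge_at i) (class_label x p)"
  by transfer simp

lemma class_label_del:
  "class_label (del_minus n i x) p = Some v \<longleftrightarrow> class_label x p = Some (skip_at i v)"
  by transfer (rule label_Del_eq_Some)

lemma class_same_sig [simp]:
  "class_same (sig_plus n i x) p q \<longleftrightarrow> class_same x p q \<or>
    (\<exists>v w. class_label x p = Some v \<and> class_label x q = Some w \<and> merge_at i v = merge_at i w)"
  by transfer simp

lemma class_same_del [simp]: "class_same (del_minus n i x) p q \<longleftrightarrow> class_same x p q"
  by transfer simp

lemma abs_fclass_in_F: "abs_fclass S \<in> F k n \<longleftrightarrow> over S k \<and> source S = n"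
  by (simp add: F_def fc_over.abs_eq fc_source.abs_eq)

lemma F_cases:
  assumes "x \<in> F k n"
  obtains S where "x = abs_fclass S" "over S k" "source S = n"
  using assms abs_fclass_in_F by (metis Quotient_abs_rep[OF Quotient_fclass])

lemma sig_plus_in_F: "x \<in> F (Suc k) n \<Longrightarrow> i < k \<Longrightarrow> sig_plus k i x \<in> F k n"
  by (auto elim!: F_cases simp: sig_plus.abs_eq abs_fclass_in_F over_Sig_iff)

lemma del_minus_in_F: "x \<in> F (Suc k) n \<Longrightarrow> i \<le> k \<Longrightarrow> del_minus k i x \<in> F k n"
  by (auto elim!: F_cases simp: del_minus.abs_eq abs_fclass_in_F over_Del_iff)

lemma class_label_bounds: "x \<in> F k n \<Longrightarrow> class_label x p = Some v \<Longrightarrow> v < k"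
  by (auto elim!: F_cases simp: class_label.abs_eq dest: label_bounds)

lemma sig_plus_swap:
  assumes "x \<in> F (Suc (Suc m)) n" "i < j" "j \<le> m"
  shows "sig_plus m (j - 1) (sig_plus (Suc m) i x) = sig_plus m i (sig_plus (Suc m) j x)"
  using assms(1)
proof (rule F_cases)
  fix S assume "x = abs_fclass S" "over S (Suc (Suc m))"
  moreover from this have "formula_eq (Sig m i (Sig (Suc m) j S)) (Sig m (j - 1) (Sig (Suc m) i S))"
    using feq_E2[of S m i "j - 1"] assms by simp
  ultimately show ?thesis by (simp add: sig_plus.abs_eq fclass.abs_eq_iff feq_sym)
qed

lemma del_minus_swap:
  assumes "x \<in> F (Suc (Suc m)) n" "i < j" "j \<le> Suc m"
  shows "del_minus m (j - 1) (del_minus (Suc m) i x) = del_minus m i (del_minus (Suc m) j x)"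
  using assms(1)
proof (rule F_cases)
  fix S assume "x = abs_fclass S" "over S (Suc (Suc m))"
  moreover from this have "formula_eq (Del m i (Del (Suc m) j S)) (Del m (j - 1) (Del (Suc m) i S))"
    using feq_E1[of S m i "j - 1"] assms by simp
  ultimately show ?thesis by (simp add: del_minus.abs_eq fclass.abs_eq_iff feq_sym)
qed

section \<open>Actions of epimorphisms and monomorphisms\<close>

lemma epi_act_hom:
  "epi_act k l e x y \<Longrightarrow> e \<in> Delta_hom k l"
  by (induction rule: epi_act.induct) (auto intro!: Delta_comp_hom sigma_hom)

lemma epi_act_semantics:
  assumes "epi_act k l e x y" "x \<in> F k n"
  shows "y \<in> F l n \<and> (\<forall>p. class_label y p = map_option e (class_label x p)) \<and>
    (\<forall>p q. class_same y p q \<longleftrightarrow> class_same x p q \<or>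
      (\<exists>v w. class_label x p = Some v \<and> class_label x q = Some w \<and> e v = e w))"
  using assms
proof (induction rule: epi_act.induct)
  case (epi_act_id k x)
  have "class_same x p q" if "class_label x p = Some v" "class_label x q = Some v" for p q v
    using that by transfer (rule same_if_label)
  moreover have "class_label x p = map_option (Delta_id k) (class_label x p)" for p
    using class_label_bounds[OF epi_act_id] by (cases "class_label x p") auto
  ultimately show ?case using epi_act_id class_label_bounds[OF epi_act_id] by auto
next
  case (epi_act_sigma i k l e x y)
  have le: "v \<le> k" if "class_label x p = Some v" for p v
    using class_label_bounds epi_act_sigma.prems that by fastforce
  have comp: "Delta_comp (Suc k) (sigma k i) e v = e (merge_at i v)" if "class_label x p = Some v" for p v
    using le[OF that] by simp
  have "map_option (Delta_comp (Suc k) (sigma k i) e) (class_label x p)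
    = map_option e (class_label (sig_plus k i x) p)" for p
    using comp by (cases "class_label x p") auto
  moreover have "(\<exists>v w. class_label x p = Some v \<and> class_label x q = Some w \<and>
      Delta_comp (Suc k) (sigma k i) e v = Delta_comp (Suc k) (sigma k i) e w) \<longleftrightarrow>
    (\<exists>v w. class_label x p = Some v \<and> class_label x q = Some w \<and>
      e (merge_at i v) = e (merge_at i w))" for p q
    using comp by auto
  ultimately show ?case
    using epi_act_sigma sig_plus_in_F[of x k n i] by auto
qed

text \<open>If \<open>e\<close> identifies \<open>i\<close> and \<open>i + 1\<close>, then it factors through $\sigma_i$, the other factor being $\delta_i e$.\<close>

lemma Delta_epi_factor:
  assumes e: "e \<in> Delta_hom (Suc k) l" "e ` {..<Suc k} = {..<l}" and i: "i < k" "e i = e (Suc i)"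
  shows "Delta_comp k (delta k i) e \<in> Delta_hom k l"
    "Delta_comp k (delta k i) e ` {..<k} = {..<l}"
    "Delta_comp (Suc k) (sigma k i) (Delta_comp k (delta k i) e) = e"
proof -
  show hom: "Delta_comp k (delta k i) e \<in> Delta_hom k l"
    using e delta_hom Delta_comp_hom by blast
  have eq: "Delta_comp k (delta k i) e (merge_at i x) = e x" if "x \<le> k" for x
    using that i by (cases "x = i") (auto simp: merge_at_def skip_at_def)
  show comp: "Delta_comp (Suc k) (sigma k i) (Delta_comp k (delta k i) e) = e"
    by (rule Delta_hom_eqI[OF Delta_comp_hom[OF sigma_hom[OF i(1)] hom] e(1)]) (simp add: eq)
  show "Delta_comp k (delta k i) e ` {..<k} = {..<l}"
  proof (intro subset_antisym subsetI)
    show "v \<in> {..<l}" if "v \<in> Delta_comp k (delta k i) e ` {..<k}" for v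
      using that hom by (auto dest: Delta_homD(1))
    fix v assume "v \<in> {..<l}"
    then obtain x where x: "x < Suc k" "e x = v" using e(2) by (metis imageE lessThan_iff)
    then have "merge_at i x < k" using i by (auto simp: merge_at_def)
    then show "v \<in> Delta_comp k (delta k i) e ` {..<k}"
      using eq[of x] x by (metis image_eqI lessThan_iff less_Suc_eq_le)
  qed
qed

lemma epi_act_exists:
  assumes "e \<in> Delta_hom k l" "e ` {..<k} = {..<l}"
  shows "\<exists>y. epi_act k l e x y"
  using assms
proof (induction k arbitrary: e x)
  case 0
  then show ?case using Delta_hom_bij_id[of e 0 l] epi_act_id by auto
next
  case (Suc k)
  show ?case
  proof (cases "\<exists>i<k. e i = e (Suc i)")
    case True
    then obtain i where i: "i < k" "e i = e (Suc i)" by blast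
    note fac = Delta_epi_factor[OF Suc.prems i]
    obtain y where "epi_act k l (Delta_comp k (delta k i) e) (sig_plus k i x) y"
      using Suc.IH fac by blast
    then show ?thesis using epi_act_sigma[OF i(1)] fac(3) by fastforce
  next
    case False
    have "e x < e y" if "x < y" "y < Suc k" for x y
    proof -
      have "e x \<le> e (Suc x)" "e (Suc x) \<le> e y" "e x \<noteq> e (Suc x)"
        using that False Delta_homD(3)[OF Suc.prems(1)] by auto
      then show ?thesis by simp
    qed
    then have "inj_on e {..<Suc k}"
      by (metis (no_types, lifting) inj_onI lessThan_iff nat_neq_iff)
    then show ?thesis using Delta_hom_bij_id[OF Suc.prems(1) _ Suc.prems(2)] epi_act_id by metis
  qed
qed

lemma epi_act_surj: "epi_act k l e x y \<Longrightarrow> e ` {..<k} = {..<l}"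
proof (induction rule: epi_act.induct)
  case (epi_act_sigma i k l e x y)
  have "Delta_comp (k + 1) (sigma k i) e ` {..<k + 1} = e ` sigma k i ` {..<Suc k}"
    by (auto simp: image_iff)
  then show ?case using sigma_epi[OF epi_act_sigma.hyps(1)] epi_act_sigma.IH
    by (simp add: Delta_epi_iff)
qed auto

lemma epi_act_inv:
  "epi_act k l e x y \<Longrightarrow> k = l \<and> e = Delta_id k \<and> y = x \<or>
    (\<exists>m i e1. k = Suc m \<and> i < m \<and> epi_act m l e1 (sig_plus m i x) y \<and>
      e = Delta_comp k (sigma m i) e1)"
  by (erule epi_act.cases) auto

text \<open>Independence of the factorization, by induction on the length. If \<open>e\<close> has factorizations
  beginning with $\sigma_i$ and $\sigma_j$ for \<open>i < j\<close>, then it also has one beginning with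
  $\sigma_i \sigma_{j-1} = \sigma_j \sigma_i$, and (E2) compares all of them.\<close>

lemma epi_act_unique:
  "epi_act k l e x y \<Longrightarrow> epi_act k l e x y' \<Longrightarrow> x \<in> F k n \<Longrightarrow> y = y'"
proof (induction k arbitrary: e x y y')
  case 0
  then show ?case using epi_act_inv[of 0 l e x y] epi_act_inv[of 0 l e x y'] by simp
next
  case (Suc k)
  have aux: "y = y'"
    if ij: "i \<le> j" "j < k"
      and 1: "epi_act k l e1 (sig_plus k i x) y" "e = Delta_comp (Suc k) (sigma k i) e1"
      and 2: "epi_act k l e2 (sig_plus k j x) y'" "e = Delta_comp (Suc k) (sigma k j) e2"
    for i j e1 e2 y y'
  proof (cases "i = j")
    case True
    have "e1 = e2"
      using sigma_epi[OF \<open>j < k\<close>] 1 2 True epi_act_hom unfolding Delta_epi_def by blast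
    then show ?thesis using Suc.IH 1 2 True sig_plus_in_F Suc.prems ij by blast
  next
    case False
    then have ij': "i < j" using ij by simp
    then obtain m where m: "k = Suc m" "j \<le> m" using ij by (cases k) auto
    have e1: "e1 (merge_at i v) = e v" if "v \<le> k" for v
      using that by (simp add: 1(2))
    have e2: "e2 (merge_at j v) = e v" if "v \<le> k" for v
      using that by (simp add: 2(2))
    have "e j = e (Suc j)" using e2[of j] e2[of "Suc j"] ij by (simp add: merge_at_def)
    then have "e1 (j - 1) = e1 j"
      using e1[of j] e1[of "Suc j"] ij ij' by (simp add: merge_at_def)
    define h where "h = Delta_comp m (delta m (j - 1)) e1"
    have hom: "e1 \<in> Delta_hom (Suc m) l" "e1 ` {..<Suc m} = {..<l}" "e2 \<in> Delta_hom (Suc m) l"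
      using 1(1) 2(1) epi_act_hom epi_act_surj m by auto
    have j: "j - 1 < m" "e1 (j - 1) = e1 (Suc (j - 1))"
      using ij' m \<open>e1 (j - 1) = e1 j\<close> by auto
    note fac = Delta_epi_factor[OF hom(1,2) j, folded h_def]
    have hm: "h (merge_at (j - 1) v) = e1 v" if "v \<le> m" for v
      using fac(3) that by (metis Delta_comp_apply sigma_apply less_Suc_eq_le)
    have "h (merge_at i v) = e2 v" if "v \<le> m" for v
    proof -
      have le: "skip_at j v \<le> k" using that m by (simp add: skip_at_def)
      then have "e2 v = e (skip_at j v)" using e2[of "skip_at j v"] by simp
      also have "\<dots> = e1 (merge_at i (skip_at j v))"
        using e1[OF le] by simp
      also have "\<dots> = h (merge_at (j - 1) (merge_at i (skip_at j v)))"
        using that ij' m by (intro hm[symmetric]) (auto simp: merge_at_def skip_at_def)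
      also have "merge_at (j - 1) (merge_at i (skip_at j v)) = merge_at i v"
        using ij' by (auto simp: merge_at_def skip_at_def)
      finally show ?thesis by simp
    qed
    then have fac2: "Delta_comp (Suc m) (sigma m i) h = e2"
      using ij' m
      by (intro Delta_hom_eqI[OF Delta_comp_hom[OF sigma_hom fac(1)] hom(3)]) auto
    obtain z where z: "epi_act m l h (sig_plus m (j - 1) (sig_plus (Suc m) i x)) z"
      using epi_act_exists fac by blast
    have "epi_act k l e1 (sig_plus k i x) z"
      using epi_act_sigma[OF j(1) z] fac(3) m by simp
    then have "y = z" using Suc.IH 1 sig_plus_in_F Suc.prems ij by (meson le_less_trans)
    have "epi_act m l h (sig_plus m i (sig_plus (Suc m) j x)) z"
      using z sig_plus_swap[of x m n i j] ij' m Suc.prems by simp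
    then have "epi_act k l e2 (sig_plus k j x) z"
      using epi_act_sigma[of i m l h _ z] fac2 ij' m by simp
    then have "y' = z" using Suc.IH 2 sig_plus_in_F Suc.prems ij by blast
    with \<open>y = z\<close> show ?thesis by simp
  qed
  have no: False
    if "e = Delta_id (Suc k)" "i < k" "e = Delta_comp (Suc k) (sigma k i) e1" for i e1
  proof -
    have "Delta_id (Suc k) v = e1 (merge_at i v)" if "v \<le> k" for v
      unfolding \<open>e = Delta_id (Suc k)\<close>[symmetric]
      by (subst \<open>e = Delta_comp (Suc k) (sigma k i) e1\<close>) (use that in simp)
    from this[of i] this[of "Suc i"] show False
      using \<open>i < k\<close> by (simp add: merge_at_def)
  qed
  from epi_act_inv[OF Suc.prems(1)] epi_act_inv[OF Suc.prems(2)] show ?case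
  proof (elim disjE exE conjE)
    fix m i e1 m' j e2
    assume "Suc k = Suc m" "i < m" "epi_act m l e1 (sig_plus m i x) y" "e = Delta_comp (Suc k) (sigma m i) e1"
      "Suc k = Suc m'" "j < m'" "epi_act m' l e2 (sig_plus m' j x) y'" "e = Delta_comp (Suc k) (sigma m' j) e2"
    then show ?thesis
      using aux[of i j e1 y e2 y'] aux[of j i e2 y' e1 y] by (cases "i \<le> j") auto
  qed (simp, (metis no nat.inject)+)
qed

lemma epi_plus_eq: "epi_act k l e x y \<Longrightarrow> x \<in> F k n \<Longrightarrow> epi_plus k l e x = y"
  unfolding epi_plus_def by (rule the_equality) (auto intro: epi_act_unique)

lemma epi_act_epi_plus:
  assumes "Delta_epi k l e" "x \<in> F k n"
  shows "epi_act k l e x (epi_plus k l e x)"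
  using assms epi_act_exists[of e k l x] epi_plus_eq[of k l e x] by (auto simp: Delta_epi_iff)

lemma epi_plus_sigma:
  assumes "x \<in> F (Suc k) n" "i < k"
  shows "epi_plus (Suc k) k (sigma k i) x = sig_plus k i x"
proof (rule epi_plus_eq[OF _ assms(1)])
  have "Delta_comp (Suc k) (sigma k i) (Delta_id k) = sigma k i"
    by (rule Delta_hom_eqI[OF Delta_comp_hom[OF sigma_hom[OF assms(2)] Delta_id_hom] sigma_hom[OF assms(2)]])
      (use assms(2) in \<open>auto simp: merge_at_def\<close>)
  then show "epi_act (Suc k) k (sigma k i) x (sig_plus k i x)"
    using epi_act_sigma[OF assms(2) epi_act_id] by fastforce
qed

lemma mono_act_hom: "mono_act k l d x y \<Longrightarrow> d \<in> Delta_hom k l"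
  by (induction rule: mono_act.induct) (auto intro!: Delta_comp_hom delta_hom)

lemma mono_act_inj: "mono_act k l d x y \<Longrightarrow> inj_on d {..<k}"
proof (induction rule: mono_act.induct)
  case (mono_act_delta i k l d x y)
  show ?case
  proof (rule inj_onI)
    fix v w assume vw: "v \<in> {..<k}" "w \<in> {..<k}"
      "Delta_comp k (delta k i) d v = Delta_comp k (delta k i) d w"
    then have "skip_at i v = skip_at i w"
      using inj_onD[OF mono_act_delta.IH, of "skip_at i v" "skip_at i w"] by (simp add: skip_at_less)
    then show "v = w" by simp
  qed
qed (auto intro: inj_onI)

lemma mono_act_semantics:
  assumes "mono_act k l d x y" "x \<in> F l n"
  shows "y \<in> F k n \<and> (\<forall>p v. class_label y p = Some v \<longleftrightarrow> v < k \<and> class_label x p = Some (d v)) \<and>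
    (\<forall>p q. class_same y p q \<longleftrightarrow> class_same x p q)"
  using assms
proof (induction rule: mono_act.induct)
  case (mono_act_id k x)
  then show ?case using class_label_bounds[OF mono_act_id] by auto
next
  case (mono_act_delta i k l d x y)
  then have "skip_at i v < k + 1 \<longleftrightarrow> v < k" for v
    by (auto simp: skip_at_def)
  then show ?case using mono_act_delta del_minus_in_F[of y k n i]
    by (auto simp: class_label_del)
qed

text \<open>A factorization of a mono is built up from the left in \<open>mono_act\<close>. The uniqueness argument
  cancels on the right instead, where $\delta$ can be cancelled, so the last factor is isolated here.\<close>

lemma mono_act_snoc_aux:
  "mono_act k l d z y \<Longrightarrow> z = del_minus l i x \<Longrightarrow> i \<le> l \<Longrightarrow>
    mono_act k (Suc l) (Delta_comp k d (delta l i)) x y"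
proof (induction rule: mono_act.induct)
  case (mono_act_id l z)
  have "Delta_comp l (Delta_id l) (delta l i) = Delta_comp l (delta l i) (Delta_id (Suc l))"
    by (rule Delta_comp_cong) (auto simp: skip_at_def)
  then show ?case
    using mono_act_delta[OF mono_act_id(2) mono_act.mono_act_id[of "l + 1" x]] mono_act_id(1) by simp
next
  case (mono_act_delta j k l d z y)
  then have "mono_act (k + 1) (Suc l) (Delta_comp (k + 1) d (delta l i)) x y" by blast
  from mono_act.mono_act_delta[OF mono_act_delta.hyps(1) this] show ?case
    by (simp add: Delta_comp_assoc[OF delta_hom])
qed

lemma mono_act_snoc:
  "i \<le> l \<Longrightarrow> mono_act k l d (del_minus l i x) y \<Longrightarrow>
    mono_act k (Suc l) (Delta_comp k d (delta l i)) x y"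
  by (rule mono_act_snoc_aux) auto

lemma mono_act_inv:
  "mono_act k l d x y \<Longrightarrow> k = l \<and> d = Delta_id l \<and> y = x \<or>
    (\<exists>m i d1. l = Suc m \<and> i \<le> m \<and> mono_act k m d1 (del_minus m i x) y \<and>
      d = Delta_comp k d1 (delta m i))"
proof (induction rule: mono_act.induct)
  case (mono_act_delta j k l d x y)
  from mono_act_delta.IH show ?case
  proof (elim disjE exE conjE)
    assume *: "k + 1 = l" "d = Delta_id l" "y = x"
    then have "Delta_comp k (delta k j) d = Delta_comp k (Delta_id k) (delta k j)"
      by (intro Delta_comp_cong) (auto simp: skip_at_def)
    then show ?thesis using * mono_act_delta.hyps(1) mono_act_id by fastforce
  next
    fix m i d1
    assume *: "l = Suc m" "i \<le> m" "mono_act (k + 1) m d1 (del_minus m i x) y"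
      "d = Delta_comp (k + 1) d1 (delta m i)"
    then have "Delta_comp k (delta k j) d = Delta_comp k (Delta_comp k (delta k j) d1) (delta m i)"
      by (simp add: Delta_comp_assoc[OF delta_hom])
    then show ?thesis using * mono_act.mono_act_delta[OF mono_act_delta.hyps(1) *(3)] by blast
  qed
qed auto

lemma Delta_mono_factor:
  assumes d: "d \<in> Delta_hom k (Suc m)" "inj_on d {..<k}" and i: "i \<le> m" "i \<notin> d ` {..<k}"
  obtains h where "h \<in> Delta_hom k m" "inj_on h {..<k}" "Delta_comp k h (delta m i) = d"
proof
  define h where "h = restrict (\<lambda>v. merge_at i (d v)) {..<k}"
  have ne: "d v \<noteq> i" if "v < k" for v using i that by auto
  have skip: "skip_at i (h v) = d v" if "v < k" for v
    using ne[OF that] that by (simp add: h_def skip_at_merge_at)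
  show h: "h \<in> Delta_hom k m"
  proof (rule Delta_homI)
    show "h v < m" if "v < k" for v
      using Delta_homD(1)[OF d(1) that] ne[OF that] that i by (auto simp: h_def merge_at_def)
    show "h v \<le> h w" if "v \<le> w" "w < k" for v w
      using that Delta_homD(3)[OF d(1) that] by (simp add: h_def merge_at_mono)
  qed (simp add: h_def)
  show "inj_on h {..<k}"
    by (rule inj_onI) (use skip inj_onD[OF d(2)] in \<open>metis lessThan_iff\<close>)
  show "Delta_comp k h (delta m i) = d"
    by (rule Delta_hom_eqI[OF Delta_comp_hom[OF h delta_hom] d(1)])
      (use skip Delta_homD(1)[OF h] in simp)
qed

lemma mono_act_exists:
  assumes "d \<in> Delta_hom k l" "inj_on d {..<k}"
  shows "\<exists>y. mono_act k l d x y"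
  using assms
proof (induction l arbitrary: d x)
  case 0
  then have "d ` {..<k} = {..<0}" by (auto dest: Delta_homD(1))
  then show ?case using Delta_hom_bij_id[OF 0] mono_act_id by metis
next
  case (Suc m)
  show ?case
  proof (cases "d ` {..<k} = {..<Suc m}")
    case True
    then show ?thesis using Delta_hom_bij_id[OF Suc.prems] mono_act_id by metis
  next
    case False
    then obtain i where i: "i \<le> m" "i \<notin> d ` {..<k}"
      using Delta_homD(1)[OF Suc.prems(1)] by fastforce
    obtain h where h: "h \<in> Delta_hom k m" "inj_on h {..<k}" "Delta_comp k h (delta m i) = d"
      using Delta_mono_factor[OF Suc.prems i] .
    obtain y where "mono_act k m h (del_minus m i x) y" using Suc.IH h by blast
    then show ?thesis using mono_act_snoc[OF i(1)] h(3) by blast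
  qed
qed

text \<open>Dual to \<open>epi_act_unique\<close>: factorizations of \<open>d\<close> ending in $\delta_i$ and $\delta_j$ with \<open>i < j\<close> are both
  compared, by (E1), with one ending in $\delta_{j-1} \delta_i = \delta_i \delta_j$.\<close>

lemma mono_act_unique:
  "mono_act k l d x y \<Longrightarrow> mono_act k l d x y' \<Longrightarrow> x \<in> F l n \<Longrightarrow> y = y'"
proof (induction l arbitrary: d x y y')
  case 0
  then show ?case using mono_act_inv[of k 0 d x y] mono_act_inv[of k 0 d x y'] by simp
next
  case (Suc l)
  have aux: "y = y'"
    if ij: "i \<le> j" "j \<le> l"
      and 1: "mono_act k l d1 (del_minus l i x) y" "d = Delta_comp k d1 (delta l i)"
      and 2: "mono_act k l d2 (del_minus l j x) y'" "d = Delta_comp k d2 (delta l j)"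
    for i j d1 d2 y y'
  proof (cases "i = j")
    case True
    have "d1 = d2"
      using delta_mono[of l j] 1 2 True mono_act_hom unfolding Delta_mono_def by metis
    moreover have "del_minus l j x \<in> F l n" using del_minus_in_F[OF Suc.prems(3) ij(2)] .
    ultimately show ?thesis using Suc.IH[of d1 "del_minus l j x" y y'] 1(1) 2(1) True by simp
  next
    case False
    then have ij': "i < j" using ij by simp
    then obtain m where m: "l = Suc m" using ij by (cases l) auto
    have hom: "d1 \<in> Delta_hom k (Suc m)" "inj_on d1 {..<k}" "d2 \<in> Delta_hom k (Suc m)"
      using 1(1) 2(1) mono_act_hom mono_act_inj m by auto
    have d1: "d v = skip_at i (d1 v)" if "v < k" for v
      using 1(2) that Delta_homD(1)[OF hom(1) that] m by simp
    have d2: "d v = skip_at j (d2 v)" if "v < k" for v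
      using 2(2) that Delta_homD(1)[OF hom(3) that] m by simp
    have "d1 v \<noteq> j - 1" if "v < k" for v
    proof
      assume "d1 v = j - 1"
      then have "d v = j" using d1[OF that] ij' by (simp add: skip_at_def)
      then show False using d2[OF that] by (auto simp: skip_at_def split: if_splits)
    qed
    then have "j - 1 \<notin> d1 ` {..<k}" by (metis imageE lessThan_iff)
    moreover have "j - 1 \<le> m" using ij m by simp
    ultimately obtain h where h: "h \<in> Delta_hom k m" "inj_on h {..<k}"
      "Delta_comp k h (delta m (j - 1)) = d1"
      using Delta_mono_factor[OF hom(1,2), of "j - 1"] by blast
    have "skip_at i (h v) = d2 v" if "v < k" for v
    proof -
      have "d1 v = skip_at (j - 1) (h v)"
        using h(3) that Delta_homD(1)[OF h(1) that] by auto
      then have "skip_at j (d2 v) = skip_at i (skip_at (j - 1) (h v))"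
        using d1[OF that] d2[OF that] by simp
      also have "\<dots> = skip_at j (skip_at i (h v))"
        using ij' by (auto simp: skip_at_def)
      finally show ?thesis by simp
    qed
    then have h2: "Delta_comp k h (delta m i) = d2"
      using Delta_homD(1)[OF h(1)]
      by (intro Delta_hom_eqI[OF Delta_comp_hom[OF h(1) delta_hom] hom(3)]) auto
    obtain z where z: "mono_act k m h (del_minus m (j - 1) (del_minus (Suc m) i x)) z"
      using mono_act_exists h by blast
    have "mono_act k l d1 (del_minus l i x) z"
      using mono_act_snoc[OF \<open>j - 1 \<le> m\<close> z] h(3) m by simp
    then have "y = z"
      using Suc.IH[OF 1(1) _ del_minus_in_F[OF Suc.prems(3)]] ij by simp
    have "mono_act k m h (del_minus m i (del_minus (Suc m) j x)) z"
      using z del_minus_swap[of x m n i j] ij ij' m Suc.prems by simp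
    then have "mono_act k l d2 (del_minus l j x) z"
      using mono_act_snoc[of i m k h] h2 ij ij' m by simp
    then have "y' = z"
      using Suc.IH[OF 2(1) _ del_minus_in_F[OF Suc.prems(3)]] ij by simp
    with \<open>y = z\<close> show ?thesis by simp
  qed
  have no: False
    if "k = Suc l" "d = Delta_id (Suc l)" "i \<le> l" "mono_act k l d1 x1 y1" "d = Delta_comp k d1 (delta l i)"
    for i d1 x1 y1
  proof -
    have "d i = i" using that(2,3) by simp
    moreover have "d i = delta l i (d1 i)" using that(1,3) by (subst that(5)) simp
    moreover have "d1 i < l" using mono_act_hom[OF that(4)] that by (simp add: Delta_homD)
    ultimately show False by (auto simp: skip_at_def split: if_splits)
  qed
  from mono_act_inv[OF Suc.prems(1)] mono_act_inv[OF Suc.prems(2)] show ?case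
  proof (elim disjE exE conjE)
    fix m i d1 m' j d2
    assume "Suc l = Suc m" "i \<le> m" "mono_act k m d1 (del_minus m i x) y" "d = Delta_comp k d1 (delta m i)"
      "Suc l = Suc m'" "j \<le> m'" "mono_act k m' d2 (del_minus m' j x) y'" "d = Delta_comp k d2 (delta m' j)"
    then show ?thesis
      using aux[of i j d1 y d2 y'] aux[of j i d2 y' d1 y] by (cases "i \<le> j") auto
  qed (simp, (metis no nat.inject)+)
qed

lemma mono_minus_eq: "mono_act k l d x y \<Longrightarrow> x \<in> F l n \<Longrightarrow> mono_minus k l d x = y"
  unfolding mono_minus_def by (rule the_equality) (auto intro: mono_act_unique)

lemma mono_act_mono_minus:
  assumes "Delta_mono k l d" "x \<in> F l n"
  shows "mono_act k l d x (mono_minus k l d x)"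
  using assms mono_act_exists[of d k l x] mono_minus_eq[of k l d x] by (auto simp: Delta_mono_iff)

lemma mono_minus_delta:
  assumes "x \<in> F (Suc k) n" "i \<le> k"
  shows "mono_minus k (Suc k) (delta k i) x = del_minus k i x"
proof (rule mono_minus_eq[OF _ assms(1)])
  have "Delta_comp k (delta k i) (Delta_id (Suc k)) = delta k i"
    by (rule Delta_hom_eqI[OF Delta_comp_hom[OF delta_hom Delta_id_hom] delta_hom])
      (auto simp: skip_at_def)
  then show "mono_act k (Suc k) (delta k i) x (del_minus k i x)"
    using mono_act_delta[OF assms(2) mono_act_id] by fastforce
qed

section \<open>Soundness of the preorders\<close>

text \<open>The partition of \<open>x\<close> is finer than that of \<open>y\<close>, and the labelling of \<open>x\<close> is a restriction of that of
  \<open>y\<close>. It is a condition on outcomes only, without reference to the levels or sources.\<close>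

definition class_le :: "fclass \<Rightarrow> fclass \<Rightarrow> bool" where
  "class_le x y \<longleftrightarrow> (\<forall>p q. class_same x p q \<longrightarrow> class_same y p q) \<and>
    (\<forall>p v. class_label x p = Some v \<longrightarrow> class_label y p = Some v)"

lemma class_le_abs: "class_le (abs_fclass S) (abs_fclass T) \<longleftrightarrow> below S (same T) (label T)"
  by (simp add: class_le_def below_def class_same.abs_eq class_label.abs_eq)

lemma class_le_trans: "class_le x y \<Longrightarrow> class_le y z \<Longrightarrow> class_le x z"
  by (auto simp: class_le_def)

lemma class_le_sig: "class_le x y \<Longrightarrow> class_le (sig_plus k i x) (sig_plus k i y)"
  unfolding class_le_def class_label_sig class_same_sig by (metis map_option_eq_Some)

lemma class_le_del: "class_le x y \<Longrightarrow> class_le (del_minus k i x) (del_minus k i y)"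
  by (simp add: class_le_def class_label_del)

lemma O1_cases:
  assumes "O1 k n x y"
  obtains S i j where "over S (k + 2)" "source S = n" "i < j" "j \<le> k"
    "x = abs_fclass (Sig k (j - 1) (Del (k + 1) i S))" "y = abs_fclass (Del k i (Sig (k + 1) j S))"
  using assms
proof (cases rule: O1.cases)
  case (1 z m i j)
  from \<open>z \<in> F (m + 1) n\<close> obtain S where S: "z = abs_fclass S" "over S (m + 1)" "source S = n"
    by (rule F_cases)
  have "m = Suc k" using 1 by simp
  then show thesis using that[of S i j] 1 S by (simp add: sig_plus.abs_eq del_minus.abs_eq)
qed

lemma O3_cases:
  assumes "O3 k n x y"
  obtains S i j where "over S (k + 2)" "source S = n" "i > j + 1" "i \<le> k + 1"
    "x = abs_fclass (Sig k j (Del (k + 1) i S))" "y = abs_fclass (Del k (i - 1) (Sig (k + 1) j S))"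
  using assms
proof (cases rule: O3.cases)
  case (1 z m i j)
  from \<open>z \<in> F (m + 1) n\<close> obtain S where S: "z = abs_fclass S" "over S (m + 1)" "source S = n"
    by (rule F_cases)
  have "m = Suc k" using 1 by simp
  then show thesis using that[of S j i] 1 S by (simp add: sig_plus.abs_eq del_minus.abs_eq)
qed

lemma O1_sound: "O1 k n x y \<Longrightarrow> x \<in> F k n \<and> y \<in> F k n \<and> class_le x y \<and> class_le y x"
  by (erule O1_cases)
    (auto simp: abs_fclass_in_F over_Sig_iff over_Del_iff class_le_abs
      intro!: formula_le_below fle_O1[simplified] fle_O1'[simplified])

lemma O3_sound: "O3 k n x y \<Longrightarrow> x \<in> F k n \<and> y \<in> F k n \<and> class_le x y \<and> class_le y x"
  by (erule O3_cases)
    (auto simp: abs_fclass_in_F over_Sig_iff over_Del_iff class_le_abs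
      intro!: formula_le_below fle_O3[simplified] fle_O3'[simplified])

lemma O2_sound: "O2 k n x y \<Longrightarrow> x \<in> F k n \<and> y \<in> F k n \<and> class_le x y"
proof (erule O2.cases)
  fix z m n' i j
  assume "k = m" "n = n'" "x = del_minus m i z" "y = sig_plus m j z" "z \<in> F (m + 1) n'"
    "i = j \<or> i = j + 1" "j < m"
  moreover from \<open>z \<in> F (m + 1) n'\<close> obtain S where "z = abs_fclass S" "over S (m + 1)" "source S = n'"
    by (rule F_cases)
  ultimately show ?thesis
    using formula_le_below[OF fle_O2[of S m i j]]
    by (auto simp: abs_fclass_in_F over_Sig_iff over_Del_iff class_le_abs sig_plus.abs_eq del_minus.abs_eq)
qed

lemma F_le_sound: "F_le k n x y \<Longrightarrow> x \<in> F k n \<and> y \<in> F k n \<and> class_le x y"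
proof (induction rule: F_le.induct)
  case (F_le_refl x k n)
  then show ?case by (simp add: class_le_def)
next
  case (F_le_trans k n x y z)
  then show ?case using class_le_trans by blast
qed (auto simp: sig_plus_in_F del_minus_in_F class_le_sig class_le_del O1_sound O2_sound O3_sound)

lemma class_same_if_label:
  "class_label x p = Some v \<Longrightarrow> class_label x q = Some v \<Longrightarrow> class_same x p q"
  by transfer (rule same_if_label)

lemma
  assumes "Delta_epi k l e" "x \<in> F k n"
  shows epi_plus_in_F: "epi_plus k l e x \<in> F l n"
    and class_label_epi_plus: "class_label (epi_plus k l e x) p = map_option e (class_label x p)"
    and class_same_epi_plus: "class_same (epi_plus k l e x) p q \<longleftrightarrow> class_same x p q \<or>
      (\<exists>v w. class_label x p = Some v \<and> class_label x q = Some w \<and> e v = e w)"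
  using epi_act_semantics[OF epi_act_epi_plus[OF assms] assms(2)] by blast+

lemma
  assumes "Delta_mono k l d" "x \<in> F l n"
  shows mono_minus_in_F: "mono_minus k l d x \<in> F k n"
    and class_label_mono_minus:
      "class_label (mono_minus k l d x) p = Some v \<longleftrightarrow> v < k \<and> class_label x p = Some (d v)"
    and class_same_mono_minus: "class_same (mono_minus k l d x) p q \<longleftrightarrow> class_same x p q"
  using mono_act_semantics[OF mono_act_mono_minus[OF assms] assms(2)] by blast+

lemma class_le_epi_plus:
  assumes "class_le x y" "x \<in> F k n" "y \<in> F k n" "Delta_epi k l e"
  shows "class_le (epi_plus k l e x) (epi_plus k l e y)"
  using assms(1)
  unfolding class_le_def class_label_epi_plus[OF assms(4,2)] class_label_epi_plus[OF assms(4,3)]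
    class_same_epi_plus[OF assms(4,2)] class_same_epi_plus[OF assms(4,3)]
  by (metis map_option_eq_Some)

lemma class_le_mono_minus:
  assumes "class_le x y" "x \<in> F l n" "y \<in> F l n" "Delta_mono k l d"
  shows "class_le (mono_minus k l d x) (mono_minus k l d y)"
  using assms(1)
  unfolding class_le_def class_label_mono_minus[OF assms(4,2)] class_label_mono_minus[OF assms(4,3)]
    class_same_mono_minus[OF assms(4,2)] class_same_mono_minus[OF assms(4,3)]
  by blast

lemma class_le_refl: "class_le x x"
  by (simp add: class_le_def)

text \<open>The operations \<open>epi_plus\<close> and \<open>mono_minus\<close> respect \<open>class_le\<close>, so it suffices to check the
  generating relation \<open>R\<close>.\<close>

lemma gen_le_sound:
  assumes R: "\<And>k n x y. R k n x y \<Longrightarrow> x \<in> F k n \<and> y \<in> F k n \<and> class_le x y"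
  shows "gen_le R k n x y \<Longrightarrow> x \<in> F k n \<and> y \<in> F k n \<and> class_le x y"
proof (induction rule: gen_le.induct)
  case (gen_le_trans k n x y z)
  then show ?case using class_le_trans by blast
qed (auto simp: class_le_refl F_le_sound R epi_plus_in_F mono_minus_in_F
    class_le_epi_plus class_le_mono_minus)

lemma beck_chevalley_sound:
  "beck_chevalley k n y z \<Longrightarrow> y \<in> F k n \<and> z \<in> F k n \<and> class_le y z"
proof (erule beck_chevalley.cases)
  fix p q r s a b c d x n'
  assume eqs: "k = r" "n = n'" "y = mono_minus r s d (epi_plus q s b x)"
      "z = epi_plus p r c (mono_minus p q a x)"
    and sq: "bicartesian_square p q r s a b c d"
    and a: "Delta_mono p q a" and d: "Delta_mono r s d" and b: "Delta_epi q s b" and c: "Delta_epi p r c"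
    and x: "x \<in> F q n'"
  define xa where "xa = mono_minus p q a x"
  define xb where "xb = epi_plus q s b x"
  have xa: "xa \<in> F p n'" and xb: "xb \<in> F s n'"
    using x by (simp_all add: xa_def xb_def mono_minus_in_F[OF a] epi_plus_in_F[OF b])
  note label_a = class_label_mono_minus[OF a x, folded xa_def]
  note same_a = class_same_mono_minus[OF a x, folded xa_def]
  note label_b = class_label_epi_plus[OF b x, folded xb_def]
  note same_b = class_same_epi_plus[OF b x, folded xb_def]
  note label_c = class_label_epi_plus[OF c xa]
  note same_c = class_same_epi_plus[OF c xa]
  note label_d = class_label_mono_minus[OF d xb]
  note same_d = class_same_mono_minus[OF d xb]
  have pb: "\<exists>t<p. a t = u \<and> c t = v" if "class_label x g = Some u" "v < r" "b u = d v" for u v g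
    using bicartesian_pullback[OF sq class_label_bounds[OF x that(1)] that(2,3)] .
  have po: "u = u' \<or> (\<exists>t<p. \<exists>t'<p. a t = u \<and> a t' = u' \<and> c t = c t')"
    if "class_label x g = Some u" "class_label x h = Some u'" "b u = b u'" for u u' g h
    using bicartesian_pushout[OF sq class_label_bounds[OF x that(1)] class_label_bounds[OF x that(2)] that(3)] .
  have "class_label (epi_plus p r c xa) g = Some v"
    if "class_label (mono_minus r s d xb) g = Some v" for g v
  proof -
    have "v < r" "class_label xb g = Some (d v)" using that by (auto simp: label_d)
    then obtain u where u: "class_label x g = Some u" "b u = d v" by (auto simp: label_b)
    then obtain t where "t < p" "a t = u" "c t = v" using pb \<open>v < r\<close> by blast
    then have "class_label xa g = Some t" using u by (simp add: label_a)
    then show ?thesis using \<open>c t = v\<close> by (simp add: label_c)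
  qed
  moreover have "class_same (epi_plus p r c xa) g h"
    if "class_same (mono_minus r s d xb) g h" for g h
  proof -
    have "class_same xb g h" using that by (simp add: same_d)
    then consider "class_same x g h"
      | u u' where "class_label x g = Some u" "class_label x h = Some u'" "b u = b u'"
      by (auto simp: same_b)
    then show ?thesis
    proof cases
      case 1
      then show ?thesis by (simp add: same_a same_c)
    next
      case (2 u u')
      from po[OF 2] show ?thesis
      proof (elim disjE exE conjE)
        assume "u = u'"
        then show ?thesis using 2 by (simp add: same_a same_c class_same_if_label)
      next
        fix t t' assume t: "t < p" "t' < p" "a t = u" "a t' = u'" "c t = c t'"
        then have "class_label xa g = Some t" "class_label xa h = Some t'"
          using 2 by (simp_all add: label_a)
        then show ?thesis using t by (auto simp: same_c)
      qed
    qed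
  qed
  ultimately have "class_le (mono_minus r s d xb) (epi_plus p r c xa)"
    by (simp add: class_le_def)
  then show ?thesis
    using mono_minus_in_F[OF d xb] epi_plus_in_F[OF c xa] by (simp add: eqs xa_def xb_def)
qed

section \<open>Both preorders on classes compare partitions and labels\<close>

lemma gen_le_sig:
  "gen_le R (Suc k) n x y \<Longrightarrow> x \<in> F (Suc k) n \<Longrightarrow> y \<in> F (Suc k) n \<Longrightarrow> i < k \<Longrightarrow>
    gen_le R k n (sig_plus k i x) (sig_plus k i y)"
  using gen_le_epi[of R "Suc k" n x y k "sigma k i"] by (simp add: epi_plus_sigma sigma_epi)

lemma gen_le_del:
  "gen_le R (Suc k) n x y \<Longrightarrow> x \<in> F (Suc k) n \<Longrightarrow> y \<in> F (Suc k) n \<Longrightarrow> i \<le> k \<Longrightarrow>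
    gen_le R k n (del_minus k i x) (del_minus k i y)"
  using gen_le_mono[of R "Suc k" n x y k "delta k i"] by (simp add: mono_minus_delta delta_mono)

lemma formula_le_imp_gen_le:
  assumes conv: "\<And>k n x y. O13_converse k n x y \<Longrightarrow> gen_le R k n x y"
  shows "formula_le S T \<Longrightarrow> over S k \<Longrightarrow> gen_le R k (source S) (abs_fclass S) (abs_fclass T)"
proof (induction arbitrary: k rule: formula_le.induct)
  case (fle_eq S T)
  then have "abs_fclass S = abs_fclass T" by (simp add: fclass.abs_eq_iff)
  then show ?case using fle_eq by (metis abs_fclass_in_F gen_le_refl)
next
  case (fle_trans S T U)
  then show ?case using formula_le_over formula_le_source by (metis gen_le_trans)
next
  case (fle_Sig S T n i)
  then have "over S (Suc n)" "over T (Suc n)" "source T = source S" "k = n" "i < n"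
    using formula_le_over formula_le_source by (auto simp: over_Sig_iff)
  then show ?case using fle_Sig.IH[of "Suc n"]
    by (simp add: sig_plus.abs_eq[symmetric] gen_le_sig abs_fclass_in_F)
next
  case (fle_Del S T n i)
  then have "over S (Suc n)" "over T (Suc n)" "source T = source S" "k = n" "i \<le> n"
    using formula_le_over formula_le_source by (auto simp: over_Del_iff)
  then show ?case using fle_Del.IH[of "Suc n"]
    by (simp add: del_minus.abs_eq[symmetric] gen_le_del abs_fclass_in_F)
next
  case (fle_O1 S m i j)
  then have "O1 (Suc m - 1) (source S) (sig_plus (Suc m - 1) (j - 1) (del_minus (Suc m) i (abs_fclass S)))
      (del_minus (Suc m - 1) i (sig_plus (Suc m) j (abs_fclass S)))"
    by (intro O1.intros) (auto simp: abs_fclass_in_F)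
  then show ?case using fle_O1.prems
    by (auto simp: sig_plus.abs_eq del_minus.abs_eq over_Sig_iff intro: gen_le_F_le F_le_O1)
next
  case (fle_O1' S m i j)
  then have "O1 (Suc m - 1) (source S) (sig_plus (Suc m - 1) (j - 1) (del_minus (Suc m) i (abs_fclass S)))
      (del_minus (Suc m - 1) i (sig_plus (Suc m) j (abs_fclass S)))"
    by (intro O1.intros) (auto simp: abs_fclass_in_F)
  then show ?case using fle_O1'.prems
    by (auto simp: sig_plus.abs_eq del_minus.abs_eq over_Del_iff O13_converse_def intro!: conv)
next
  case (fle_O2 S m i j)
  then have "O2 m (source S) (del_minus m i (abs_fclass S)) (sig_plus m j (abs_fclass S))"
    by (intro O2.intros) (auto simp: abs_fclass_in_F)
  then show ?case using fle_O2.prems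
    by (auto simp: sig_plus.abs_eq del_minus.abs_eq over_Del_iff intro: gen_le_F_le F_le_O2)
next
  case (fle_O3 S m i j)
  then have "O3 (Suc m - 1) (source S) (sig_plus (Suc m - 1) j (del_minus (Suc m) i (abs_fclass S)))
      (del_minus (Suc m - 1) (i - 1) (sig_plus (Suc m) j (abs_fclass S)))"
    by (intro O3.intros) (auto simp: abs_fclass_in_F)
  then show ?case using fle_O3.prems
    by (auto simp: sig_plus.abs_eq del_minus.abs_eq over_Sig_iff intro: gen_le_F_le F_le_O3)
next
  case (fle_O3' S m i j)
  then have "O3 (Suc m - 1) (source S) (sig_plus (Suc m - 1) j (del_minus (Suc m) i (abs_fclass S)))
      (del_minus (Suc m - 1) (i - 1) (sig_plus (Suc m) j (abs_fclass S)))"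
    by (intro O3.intros) (auto simp: abs_fclass_in_F)
  then show ?case using fle_O3'.prems
    by (auto simp: sig_plus.abs_eq del_minus.abs_eq over_Del_iff O13_converse_def intro!: conv)
qed

lemma gen_le_complete:
  assumes conv: "\<And>k n x y. O13_converse k n x y \<Longrightarrow> gen_le R k n x y"
    and "x \<in> F k n" "y \<in> F k n" "class_le x y"
  shows "gen_le R k n x y"
proof -
  obtain S where S: "x = abs_fclass S" "over S k" "source S = n" using assms(2) by (rule F_cases)
  obtain T where T: "y = abs_fclass T" "over T k" "source T = n" using assms(3) by (rule F_cases)
  have "formula_le S T"
    using formula_le_complete S T assms(4) by (simp add: class_le_abs)
  then show ?thesis using formula_le_imp_gen_le[OF conv] S T by blast
qed

lemma F_le'_iff:
  assumes "x \<in> F k n" "y \<in> F k n"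
  shows "F_le' k n x y \<longleftrightarrow> class_le x y"
proof
  show "class_le x y" if "F_le' k n x y"
  proof -
    have "x \<in> F k n \<and> y \<in> F k n \<and> class_le x y" if "O13_converse k n x y" for k n x y
      using that O1_sound O3_sound unfolding O13_converse_def by blast
    from gen_le_sound[OF this] show ?thesis using that by (simp add: F_le'_def)
  qed
  show "F_le' k n x y" if "class_le x y"
    unfolding F_le'_def by (rule gen_le_complete[OF gen_le_base assms that])
qed

text \<open>The instances of (O1) and (O3) come from the bicartesian squares formed by one $\sigma$ and one $\delta$.\<close>

lemma beck_chevalley_O13_converse:
  assumes "O13_converse k n x y"
  shows "beck_chevalley k n x y"
proof -
  have lower: "beck_chevalley k n y x" if "O1 k n x y" for x y
    using that
  proof (cases rule: O1.cases)
    case (1 z m i j)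
    then have m: "m = Suc k" by simp
    have xy: "x = sig_plus k (j - 1) (del_minus (Suc k) i z)" "y = del_minus k i (sig_plus (Suc k) j z)"
      and z: "z \<in> F (Suc (Suc k)) n" and ij: "i < j" "j < Suc k"
      using 1 by (simp_all add: m)
    have "beck_chevalley k n
      (mono_minus k (Suc k) (delta k i) (epi_plus (Suc (Suc k)) (Suc k) (sigma (Suc k) j) z))
      (epi_plus (Suc k) k (sigma k (j - 1)) (mono_minus (Suc k) (Suc (Suc k)) (delta (Suc k) i) z))"
      using ij z by (intro beck_chevalley.intros bicartesian_sigma_delta_lower delta_mono sigma_epi) auto
    moreover have "del_minus (Suc k) i z \<in> F (Suc k) n" "sig_plus (Suc k) j z \<in> F (Suc k) n"
      using ij by (auto intro!: del_minus_in_F sig_plus_in_F z)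
    moreover have "i \<le> k" "j - 1 < k" using ij by auto
    ultimately show ?thesis
      using ij z by (simp add: xy epi_plus_sigma mono_minus_delta)
  qed
  have upper: "beck_chevalley k n y x" if "O3 k n x y" for x y
    using that
  proof (cases rule: O3.cases)
    case (1 z m i j)
    then have m: "m = Suc k" by simp
    have xy: "x = sig_plus k j (del_minus (Suc k) i z)" "y = del_minus k (i - 1) (sig_plus (Suc k) j z)"
      and z: "z \<in> F (Suc (Suc k)) n" and ij: "j + 1 < i" "i \<le> Suc k"
      using 1 by (simp_all add: m)
    have "beck_chevalley k n
      (mono_minus k (Suc k) (delta k (i - 1)) (epi_plus (Suc (Suc k)) (Suc k) (sigma (Suc k) j) z))
      (epi_plus (Suc k) k (sigma k j) (mono_minus (Suc k) (Suc (Suc k)) (delta (Suc k) i) z))"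
      using ij z by (intro beck_chevalley.intros bicartesian_sigma_delta_upper delta_mono sigma_epi) auto
    moreover have "del_minus (Suc k) i z \<in> F (Suc k) n" "sig_plus (Suc k) j z \<in> F (Suc k) n"
      using ij by (auto intro!: del_minus_in_F sig_plus_in_F z)
    moreover have "i - 1 \<le> k" "j < k" using ij by auto
    ultimately show ?thesis
      using ij z by (simp add: xy epi_plus_sigma mono_minus_delta)
  qed
  show ?thesis using assms lower upper by (auto simp: O13_converse_def)
qed

lemma F_le''_iff:
  assumes "x \<in> F k n" "y \<in> F k n"
  shows "F_le'' k n x y \<longleftrightarrow> class_le x y"
proof
  show "class_le x y" if "F_le'' k n x y"
    using gen_le_sound[OF beck_chevalley_sound] that by (simp add: F_le''_def)
  show "F_le'' k n x y" if "class_le x y"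
    unfolding F_le''_def
    by (rule gen_le_complete[OF gen_le_base[OF beck_chevalley_O13_converse] assms that])
qed

section \<open>Noncrossing partitions\<close>

text \<open>Take a related pair \<open>a < c\<close> at minimal distance. If \<open>c\<close> is not \<open>a + 1\<close>, then the class of \<open>a + 1\<close>
  cannot leave the gap between \<open>a\<close> and \<open>c\<close>, and minimality makes it a singleton.\<close>

lemma noncrossing_adjacent_or_singleton:
  fixes R :: "nat \<Rightarrow> nat \<Rightarrow> bool"
  assumes symR: "\<And>x y. R x y \<Longrightarrow> R y x" and transR: "\<And>x y z. R x y \<Longrightarrow> R y z \<Longrightarrow> R x z"
    and bound: "\<And>x y. R x y \<Longrightarrow> x < n \<and> y < n"
    and nc: "\<And>a b c d. R a c \<Longrightarrow> R b d \<Longrightarrow> a < b \<Longrightarrow> b < c \<Longrightarrow> c < d \<Longrightarrow> R a b"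
    and "0 < n"
  shows "(\<exists>j. R j (Suc j)) \<or> (\<exists>j<n. \<forall>y. R j y \<longrightarrow> y = j)"
proof (cases "\<exists>a c. a < c \<and> R a c")
  case True
  define P where "P d \<longleftrightarrow> (\<exists>a c. a < c \<and> R a c \<and> c - a = d)" for d
  define d where "d = (LEAST d. P d)"
  have "\<exists>d. P d" using True by (auto simp: P_def)
  then have "P d" unfolding d_def by (metis LeastI)
  then obtain a c where ac: "a < c" "R a c" "c - a = d" by (auto simp: P_def)
  have least: "d \<le> y - x" if "x < y" "R x y" for x y
    unfolding d_def by (rule Least_le) (use that in \<open>auto simp: P_def\<close>)
  show ?thesis
  proof (cases "c = Suc a")
    case True
    then show ?thesis using ac by blast
  next
    case False
    then have lt: "Suc a < c" using ac by simp
    have no: "\<not> R (Suc a) a" "\<not> R (Suc a) c"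
      using least[of a "Suc a"] least[of "Suc a" c] lt ac symR[of "Suc a" a] by auto
    have "y = Suc a" if y: "R (Suc a) y" for y
    proof (rule ccontr)
      assume ne: "y \<noteq> Suc a"
      consider "y < a" | "y = a" | "Suc a < y" "y < c" | "y = c" | "c < y" using ne by linarith
      then show False
      proof cases
        case 1
        then have "R y a" using nc[of y "Suc a" a c] symR[OF y] ac lt by simp
        then show False using transR[OF y] no by blast
      next
        case 3
        then show False using least[OF _ y] lt ac by simp
      next
        case 5
        then have "R a (Suc a)" using nc[OF \<open>R a c\<close> y] lt by simp
        then show False using symR no by blast
      qed (use y no in auto)
    qed
    moreover have "Suc a < n" using bound[OF \<open>R a c\<close>] lt by simp
    ultimately show ?thesis by blast
  qed
next
  case False
  then have "y = x" if "R x y" for x y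
    using that symR by (metis nat_neq_iff)
  then show ?thesis using \<open>0 < n\<close> by blast
qed

text \<open>Every noncrossing equivalence relation \<open>R\<close> on \<open>{..<n}\<close> is the block relation of a formula over \<open>0\<close>,
  by induction on \<open>n\<close>: an adjacent related pair is contributed by a first $\sigma_j$, a singleton class
  by a first $\delta_j$.\<close>

lemma noncrossing_realized:
  assumes "\<And>x. x < n \<Longrightarrow> R x x" "\<And>x y. R x y \<Longrightarrow> R y x" "\<And>x y z. R x y \<Longrightarrow> R y z \<Longrightarrow> R x z"
    and "\<And>x y. R x y \<Longrightarrow> x < n \<and> y < n"
    and "\<And>a b c d. R a c \<Longrightarrow> R b d \<Longrightarrow> a < b \<Longrightarrow> b < c \<Longrightarrow> c < d \<Longrightarrow> R a b"
  shows "\<exists>S. over S 0 \<and> source S = n \<and> (\<forall>x y. same S x y \<longleftrightarrow> R x y)"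
  using assms
proof (induction n arbitrary: R)
  case 0
  have "\<not> R x y" for x y using 0(4) by blast
  then show ?case by (intro exI[of _ "Atom 0"]) (auto intro: over.intros)
next
  case (Suc n)
  note bound = Suc.prems(4)
  have skip_lt: "x < n" if "skip_at j x < Suc n" "j \<le> n" for j x
    using that by (auto simp: skip_at_def split: if_splits)
  have IH: "\<exists>S. over S 0 \<and> source S = n \<and> (\<forall>x y. same S x y \<longleftrightarrow> R (skip_at j x) (skip_at j y))"
    if "j \<le> n" for j
  proof (rule Suc.IH)
    show "R (skip_at j x) (skip_at j x)" if "x < n" for x
      using Suc.prems(1) that skip_at_less by blast
    show "x < n \<and> y < n" if "R (skip_at j x) (skip_at j y)" for x y
      using bound[OF that] skip_lt \<open>j \<le> n\<close> by blast
    show "R (skip_at j a) (skip_at j b)"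
      if "R (skip_at j a) (skip_at j c)" "R (skip_at j b) (skip_at j d)" "a < b" "b < c" "c < d" for a b c d
      using Suc.prems(5)[OF that(1,2)] that(3-5) by simp
  qed (use Suc.prems(2,3) in blast)+
  have "(\<exists>j. R j (Suc j)) \<or> (\<exists>j<Suc n. \<forall>y. R j y \<longrightarrow> y = j)"
    by (rule noncrossing_adjacent_or_singleton[of R "Suc n"]) (fact Suc.prems | simp)+
  then consider j where "R j (Suc j)" | j where "j \<le> n" "\<forall>y. R j y \<longrightarrow> y = j"
    by (auto simp: less_Suc_eq_le)
  then show ?case
  proof cases
    case (1 j)
    then have j: "j < n" using bound by fastforce
    obtain S where S: "over S 0" "source S = n" "\<And>x y. same S x y \<longleftrightarrow> R (skip_at j x) (skip_at j y)"
      using IH[of j] j by auto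
    have over: "over (front_sig j S) 0" using S j over_front_sig by simp
    have R_skip: "R x (skip_at j (merge_at j x))" if "x \<le> n" for x
      using Suc.prems(1)[of x] that 1 by (cases "x = j") (auto simp: skip_at_def merge_at_def)
    have "same (front_sig j S) x y \<longleftrightarrow> R x y" if xy: "x \<le> n" "y \<le> n" for x y
    proof -
      have "same (front_sig j S) x y \<longleftrightarrow> x = y \<or> merge_at j x = merge_at j y
        \<or> R (skip_at j (merge_at j x)) (skip_at j (merge_at j y))"
        using xy j S by (simp add: same_front_sig)
      moreover have "R x y \<longleftrightarrow> R (skip_at j (merge_at j x)) (skip_at j (merge_at j y))"
        using R_skip[OF xy(1)] R_skip[OF xy(2)] Suc.prems(2,3) by blast
      moreover have "R x y" if "merge_at j x = merge_at j y"
        using R_skip[OF xy(1)] R_skip[OF xy(2)] Suc.prems(2,3) that by metis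
      ultimately show ?thesis using Suc.prems(1)[of x] xy by auto
    qed
    moreover have "x \<le> n \<and> y \<le> n" if "same (front_sig j S) x y" for x y
      using same_bounds[OF over that] S by simp
    moreover have "x \<le> n \<and> y \<le> n" if "R x y" for x y using bound[OF that] by simp
    ultimately have "same (front_sig j S) x y \<longleftrightarrow> R x y" for x y by blast
    then show ?thesis using over S(2) by (intro exI[of _ "front_sig j S"]) simp
  next
    case (2 j)
    obtain S where S: "over S 0" "source S = n" "\<And>x y. same S x y \<longleftrightarrow> R (skip_at j x) (skip_at j y)"
      using IH[of j] 2 by auto
    have over: "over (front_del j S) 0" using S 2 over_front_del by simp
    have "same (front_del j S) x y \<longleftrightarrow> R x y" if xy: "x \<le> n" "y \<le> n" for x y
    proof (cases "x = j \<or> y = j")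
      case True
      have "same (front_del j S) j z \<longleftrightarrow> z = j" "R j z \<longleftrightarrow> z = j" for z
        using 2 S Suc.prems(1)[of j] by (auto simp: same_front_del_self)
      then show ?thesis using True same_sym Suc.prems(2) by metis
    next
      case False
      then obtain a b where ab: "x = skip_at j a" "y = skip_at j b" using skip_at_surj by meson
      then have lt: "a < n" "b < n" using xy 2 skip_lt[of j] by auto
      then have "same (front_del j S) x y \<longleftrightarrow> a = b \<or> same S a b"
        using 2 S by (simp add: ab same_front_del_skip)
      then show ?thesis using S(3) Suc.prems(1)[of x] xy ab by auto
    qed
    moreover have "x \<le> n \<and> y \<le> n" if "same (front_del j S) x y" for x y
      using same_bounds[OF over that] S by simp
    moreover have "x \<le> n \<and> y \<le> n" if "R x y" for x y using bound[OF that] by simp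
    ultimately have "same (front_del j S) x y \<longleftrightarrow> R x y" for x y by blast
    then show ?thesis using over S(2) by (intro exI[of _ "front_del j S"]) simp
  qed
qed

text \<open>The partition of the points into blocks, open or closed.\<close>

definition class_partition :: "fclass \<Rightarrow> nat set set" where
  "class_partition x = {..<fc_source x} // {(p, q). class_same x p q}"

lemma class_same_equiv:
  assumes "x \<in> F k n"
  shows "equiv {..<n} {(p, q). class_same x p q}"
  using assms
proof (rule F_cases)
  fix S assume S: "x = abs_fclass S" "over S k" "source S = n"
  show ?thesis
    unfolding S(1) class_same.abs_eq
  proof (rule equivI)
    show "{(p, q). same S p q} \<subseteq> {..<n} \<times> {..<n}" using same_bounds[OF S(2)] S(3) by auto
    show "refl_on {..<n} {(p, q). same S p q}" using same_refl[of _ S] S(3) by (auto simp: refl_on_def)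
    show "sym {(p, q). same S p q}" by (auto intro: symI same_sym)
    show "trans {(p, q). same S p q}" by (auto intro: transI same_trans)
  qed
qed

lemma class_partition_F:
  "x \<in> F k n \<Longrightarrow> class_partition x = {..<n} // {(p, q). class_same x p q}"
  by (simp add: class_partition_def F_def)

lemma class_partition_in_K:
  assumes "x \<in> F k n"
  shows "class_partition x \<in> K n"
proof -
  note eq = class_same_equiv[OF assms]
  have nc: "class_same x a b"
    if "class_same x a c" "class_same x b d" "a < b" "b < c" "c < d" for a b c d
    using assms that by (auto elim!: F_cases simp: class_same.abs_eq intro: same_noncrossing)
  have "noncrossing (class_partition x)"
    unfolding noncrossing_def
  proof (rule notI, elim exE bexE conjE)
    fix a b c d X Y
    assume abcd: "a < b" "b < c" "c < d"
      and X: "X \<in> class_partition x" "a \<in> X" "c \<in> X" and Y: "Y \<in> class_partition x" "b \<in> Y" "d \<in> Y"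
      and "X \<noteq> Y"
    have "class_same x a c" "class_same x b d"
      using quotient_eq_iff[OF eq, of X X a c] quotient_eq_iff[OF eq, of Y Y b d] X Y
      by (auto simp: class_partition_F[OF assms])
    then have "class_same x a b" using nc abcd by blast
    then have "X = Y" using quotient_eq_iff[OF eq, of X Y a b] X Y
      by (auto simp: class_partition_F[OF assms])
    with \<open>X \<noteq> Y\<close> show False by blast
  qed
  then show ?thesis
    using partition_on_quotient[OF eq] by (simp add: K_def class_partition_F[OF assms])
qed

lemma class_partition_surj:
  assumes "P \<in> K n"
  shows "\<exists>x \<in> F 0 n. class_partition x = P"
proof -
  have part: "partition_on {..<n} P" and nc: "noncrossing P"
    using assms by (auto simp: K_def)
  define R where "R x y \<longleftrightarrow> (\<exists>X\<in>P. x \<in> X \<and> y \<in> X)" for x y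
  have eq: "equiv {..<n} {(x, y). R x y}"
    using equiv_partition_on[OF part] by (simp add: R_def)
  have "\<exists>S. over S 0 \<and> source S = n \<and> (\<forall>x y. same S x y \<longleftrightarrow> R x y)"
  proof (rule noncrossing_realized)
    show "R x x" if "x < n" for x using equivE[OF eq] that by (auto simp: refl_on_def)
    show "R y x" if "R x y" for x y using that by (auto simp: R_def)
    show "R x z" if "R x y" "R y z" for x y z using equivE[OF eq] that by (auto dest: transD)
    show "x < n \<and> y < n" if "R x y" for x y
      using that partition_onD1[OF part] by (auto simp: R_def)
    show "R a b" if "R a c" "R b d" "a < b" "b < c" "c < d" for a b c d
    proof -
      obtain X Y where XY: "X \<in> P" "a \<in> X" "c \<in> X" "Y \<in> P" "b \<in> Y" "d \<in> Y"
        using \<open>R a c\<close> \<open>R b d\<close> by (auto simp: R_def)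
      then have "X = Y" using nc that(3-5) unfolding noncrossing_def by blast
      then show ?thesis using XY by (auto simp: R_def)
    qed
  qed
  then obtain S where S: "over S 0" "source S = n" "\<And>x y. same S x y \<longleftrightarrow> R x y" by blast
  have F: "abs_fclass S \<in> F 0 n" using S by (simp add: abs_fclass_in_F)
  have "class_partition (abs_fclass S) = {..<n} // {(x, y). R x y}"
    using S by (simp add: class_partition_F[OF F] class_same.abs_eq)
  also have "\<dots> = P" using partition_on_eq_quotient[OF part] by (simp add: R_def)
  finally show ?thesis using F by blast
qed

lemma refines_quotient_iff:
  assumes r: "equiv A r" and s: "equiv A s"
  shows "refines A (A // r) (A // s) \<longleftrightarrow> r \<subseteq> s"
proof
  assume ref: "refines A (A // r) (A // s)"
  show "r \<subseteq> s"
  proof safe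
    fix x y assume xy: "(x, y) \<in> r"
    then have x: "x \<in> A" using equiv_type[OF r] by blast
    then have "r `` {x} \<in> A // r" by (rule quotientI)
    then obtain Y where Y: "Y \<in> A // s" "r `` {x} \<subseteq> Y"
      using ref by (auto simp only: refines_def)
    moreover have "x \<in> r `` {x}" "y \<in> r `` {x}" using xy equiv_class_self[OF r x] by auto
    ultimately show "(x, y) \<in> s" using quotient_eq_iff[OF s, of Y Y x y] by auto
  qed
next
  assume "r \<subseteq> s"
  then show "refines A (A // r) (A // s)"
    using partition_on_quotient[OF r] partition_on_quotient[OF s]
    by (auto simp: refines_def quotient_def)
qed

text \<open>Over \<open>0\<close> there are no open positions, so the condition on labels is void.\<close>

lemma class_le_iff_refines:
  assumes "x \<in> F 0 n" "y \<in> F 0 n"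
  shows "class_le x y \<longleftrightarrow> refines {..<n} (class_partition x) (class_partition y)"
proof -
  have "class_label x p = None" for p
    using class_label_bounds[OF assms(1)] by (cases "class_label x p") auto
  then show ?thesis
    using refines_quotient_iff[OF class_same_equiv[OF assms(1)] class_same_equiv[OF assms(2)]]
    by (auto simp: class_le_def class_partition_F[OF assms(1)] class_partition_F[OF assms(2)])
qed

text \<open>A surjection \<open>f\<close> onto a partial order that preserves and reflects the order induces an
  isomorphism from the quotient.\<close>

lemma order_isomorphic_preorder_quotient:
  assumes le: "\<And>x y. x \<in> A \<Longrightarrow> y \<in> A \<Longrightarrow> le x y \<longleftrightarrow> leB (f x) (f y)"
    and f: "f ` A = B"
    and leB_refl: "\<And>b. b \<in> B \<Longrightarrow> leB b b"
    and leB_antisym: "\<And>b c. leB b c \<Longrightarrow> leB c b \<Longrightarrow> b = c"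
  shows "order_isomorphic (preorder_quotient A le) (quotient_le le) B leB"
proof -
  define C where "C x = {y \<in> A. f y = f x}" for x
  have "le x y \<and> le y x \<longleftrightarrow> f x = f y" if "x \<in> A" "y \<in> A" for x y
    using that le f leB_refl leB_antisym by (metis image_eqI)
  then have r: "{(x, y). x \<in> A \<and> y \<in> A \<and> le x y \<and> le y x} = {(x, y). x \<in> A \<and> y \<in> A \<and> f x = f y}"
    by auto
  have "preorder_quotient A le = (\<lambda>x. {(x, y). x \<in> A \<and> y \<in> A \<and> f x = f y} `` {x}) ` A"
    unfolding preorder_quotient_def r quotient_def by blast
  also have "\<dots> = C ` A"
    by (intro image_cong) (auto simp: C_def)
  finally have quot: "preorder_quotient A le = C ` A" .
  define g where "g X = f (SOME x. x \<in> X)" for X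
  have g: "g (C x) = f x" if "x \<in> A" for x
  proof -
    have "(SOME y. y \<in> C x) \<in> C x" by (rule someI[of _ x]) (simp add: C_def that)
    then show ?thesis by (simp add: g_def C_def)
  qed
  have C_eq: "C x = C y \<longleftrightarrow> f x = f y" if "x \<in> A" "y \<in> A" for x y
    using that by (auto simp: C_def)
  have "inj_on g (C ` A)"
    by (rule inj_onI) (metis C_eq g imageE)
  moreover have "g ` C ` A = B"
    using f by (force simp: g image_iff)
  ultimately have "bij_betw g (C ` A) B" by (simp add: bij_betw_def)
  moreover have "quotient_le le (C x) (C y) \<longleftrightarrow> leB (g (C x)) (g (C y))"
    if "x \<in> A" "y \<in> A" for x y
    using that le unfolding quotient_le_def g[OF that(1)] g[OF that(2)] by (auto simp: C_def)
  ultimately have "bij_betw g (C ` A) B \<and>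
      (\<forall>X \<in> C ` A. \<forall>Y \<in> C ` A. quotient_le le X Y \<longleftrightarrow> leB (g X) (g Y))"
    by blast
  then show ?thesis unfolding order_isomorphic_def quot by (intro exI[of _ g])
qed

theorem proposition5p7:
  fixes n :: nat
  shows "(\<forall>k l. \<forall>x \<in> F k l. \<forall>y \<in> F k l. F_le' k l x y \<longleftrightarrow> F_le'' k l x y) \<and>
    order_isomorphic (preorder_quotient (F 0 n) (F_le' 0 n)) (quotient_le (F_le' 0 n))
      (K n) (refines {..<n})"
proof
  show "\<forall>k l. \<forall>x \<in> F k l. \<forall>y \<in> F k l. F_le' k l x y \<longleftrightarrow> F_le'' k l x y"
    by (simp add: F_le'_iff F_le''_iff)
  show "order_isomorphic (preorder_quotient (F 0 n) (F_le' 0 n)) (quotient_le (F_le' 0 n))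
      (K n) (refines {..<n})"
  proof (rule order_isomorphic_preorder_quotient)
    show "F_le' 0 n x y \<longleftrightarrow> refines {..<n} (class_partition x) (class_partition y)"
      if "x \<in> F 0 n" "y \<in> F 0 n" for x y
      using that by (simp add: F_le'_iff class_le_iff_refines)
    show "class_partition ` F 0 n = K n"
      using class_partition_in_K class_partition_surj by blast
    show "refines {..<n} P P" if "P \<in> K n" for P
      using that by (simp add: K_def refines_refl)
  qed (rule refines_asym)
qed

end
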